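(* Let $M$ be a compact oriented PL $n$-manifold with $\partial M=\overline{M_{\mathrm{in}}}\sqcup M_{\mathrm{out}}$, $X$ a finite regular CW decomposition of $M$ of product type near $M_{\mathrm{out}}$, and $E$ a flat vector bundle over $M$ of rank $m$ with a horizontal fiberwise density. Let $\mathcal F=C^\bullet(X,E)[1]\oplus C^\bullet(X^\vee,E^* )[n-2]$ with superfields $A,B$, and let $\omega=\langle\delta B,\delta A\rangle$, $S=\langle B,dA\rangle+\langle B|_{\mathrm{in}},A|_{\mathrm{in}}\rangle_{\mathrm{in}}$, let $Q$ be the degree $+1$ vector field on $\mathcal F$ with $QA=dA$, $QB=dB$, and let $\pi:\mathcal F\to\mathcal F_\partial$ be the projection to boundary fields and $\alpha_\partial=\langle B_{\mathrm{out}},\delta A_{\mathrm{out}}\rangle_{\mathrm{out}}-\langle\delta B_{\mathrm{in}},A_{\mathrm{in}}\rangle_{\mathrm{in}}\in\Omega^1(\mathcal F_\partial)$. Then $$\delta S=\iota_Q\omega-\pi^*\alpha_\partial .$$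
   Context: Geometry. $M_{\mathrm{out}}$ carries the induced orientation and $M_{\mathrm{in}}$ the opposite one. Cells of $X$ are finite unions of simplices of a PL triangulation; $X$ induces decompositions $X_{\mathrm{in}},X_{\mathrm{out}}$ of $M_{\mathrm{in}},M_{\mathrm{out}}$. Product type near $M_{\mathrm{out}}$: for each $k$-cell $\tilde e$ of $X_{\mathrm{out}}$ there is a unique $(k+1)$-cell $e$ of $X-X_{\mathrm{out}}$ with $\tilde e\subset\partial e$. For a cell $e$ of $X$ let $\varkappa(e)$ be the dual $(n-\dim e)$-cell (built from the barycentric subdivision), and for a boundary cell $e$ let $\varkappa_{\mathrm{in}}(e)$ or $\varkappa_{\mathrm{out}}(e)$ be the $(n-1-\dim e)$-cell dual to $e$ inside the boundary. $X^\vee$ is the CW complex with cells $\varkappa(e)$, $e\subset X-X_{\mathrm{out}}$, and $\varkappa_{\mathrm{in}}(e)$, $e\subset X_{\mathrm{in}}$ (a decomposition of $M$ with a collar at $M_{\mathrm{in}}$ added and a collar at $M_{\mathrm{out}}$ removed). $X^\vee_{\mathrm{in}}\subset X^\vee$ is the subcomplex of cells $\varkappa_{\mathrm{in}}(e)$; $X_{\mathrm{out}}^\vee$, with cells $\varkappa_{\mathrm{out}}(\tilde e)$, embeds in $X^\vee$ by sending $\varkappa_{\mathrm{out}}(\tilde e)$ to $\varkappa(e)$ with $e$ the unique cell of $X-X_{\mathrm{out}}$ adjacent to $\tilde e$. Dual cells are oriented so that $e_i\cdot\varkappa(e_j)=\delta_{ij}$, and similarly on the boundary. Cochains. $E$ also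 denotes the cellular local system: $E(e>e')$ is the parallel transport from the barycenter $\dot e'$ to $\dot e$ inside $\bar e$, and $(da)_e=\sum_{e'}[e:e']E(e>e')a_{e'}$ on $C^\bullet(X,E)$; similarly for $C^\bullet(X^\vee,E^* )$ with the dual bundle (transport between $\varkappa_{\mathrm{in}}(e)$ and $\varkappa(e)$ being trivial). $\langle\,,\rangle:C^{n-\bullet}(X^\vee,E^* )\otimes C^\bullet(X,E)\to\mathbb R$ is the inverse of the non-degenerate intersection pairing of $C(X,X_{\mathrm{out}})$ with $C(X^\vee,X^\vee_{\mathrm{in}})$, pairing $\varkappa(e)^*$ with $e^*$ for $e\subset X-X_{\mathrm{out}}$, extended by zero to cochains supported on $X^\vee_{\mathrm{in}}$ or on $X_{\mathrm{out}}$; for Koszul signs the comma carries degree $-n$. $\langle\,,\rangle_{\mathrm{in/out}}$ are the analogous inverse intersection pairings on $X^\vee_{\mathrm{in/out}}$, $X_{\mathrm{in/out}}$. $a|_{\mathrm{in}},a|_{\mathrm{out}}$ are restrictions of $a\in C^\bullet(X,E)$; for $b\in C^\bullet(X^\vee,E^* )$, $b|_{\mathrm{in}}$ is the restriction to $X_{\mathrm{in}}^\vee$, and $b|_{\mathrm{out}}$ is the pullback along $X_{\mathrm{out}}^\vee\hookrightarrow X^\vee$ composed with parallel transport by $E^*$ from $\dot e$ to $\dot{\tilde e}$. Fields. The components of the superfields $A=\sum_{e\subset X}e^*A_e$, $B=\sum_{e^\vee\subset X^\vee}B_{e^\vee}(e^\vee)^*$ are coordinates on $\mathcal F$ with $|A_e|=1-\dim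 e$, $|B_{e^\vee}|=n-2-\dim e^\vee$. $\delta$ is the de Rham differential on $\mathcal F$ (or $\mathcal F_\partial$), $\iota_Q$ is contraction. $\mathcal F_\partial=C^\bullet(X_\partial,E)[1]\oplus C^\bullet(X_\partial^\vee,E^* )[n-2]$ with $X_\partial=X_{\mathrm{in}}\sqcup X_{\mathrm{out}}$ and superfields $A_{\mathrm{in}},A_{\mathrm{out}},B_{\mathrm{in}},B_{\mathrm{out}}$; $\pi$ is $(A,B)\mapsto(A|_{\mathrm{in}},A|_{\mathrm{out}},B|_{\mathrm{in}},B|_{\mathrm{out}})$. *)

theory Defs
  imports "HOL-Analysis.Analysis" "HOL-Library.Poly_Mapping"
begin

section \<open>PL manifolds\<close>

definition affine_map_on :: "'a::euclidean_space set \<Rightarrow> ('a \<Rightarrow> 'a) \<Rightarrow> bool" where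
  "affine_map_on S f \<longleftrightarrow> (\<exists>L c. linear L \<and> (\<forall>x\<in>S. f x = L x + c))"

definition PL_homeomorphic :: "'a::euclidean_space set \<Rightarrow> 'a set \<Rightarrow> bool" where
  "PL_homeomorphic P N \<longleftrightarrow>
     (\<exists>f g T. homeomorphism P N f g \<and> simplicial_complex T \<and> \<Union>T = P \<and>
              (\<forall>S\<in>T. affine_map_on S f))"

definition PL_ball :: "nat \<Rightarrow> 'a::euclidean_space set \<Rightarrow> bool" where
  "PL_ball k N \<longleftrightarrow> (\<exists>P. polytope P \<and> aff_dim P = int k \<and> PL_homeomorphic P N)"

definition compact_PL_manifold :: "nat \<Rightarrow> 'a::euclidean_space set \<Rightarrow> bool" where
  "compact_PL_manifold n M \<longleftrightarrow>
     (\<exists>T. simplicial_complex T \<and> \<Union>T = M) \<and>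
     (\<forall>x\<in>M. \<exists>N U. PL_ball n N \<and> N \<subseteq> M \<and> openin (top_of_set M) U \<and> x \<in> U \<and> U \<subseteq> N)"

definition manifold_boundary :: "nat \<Rightarrow> 'a::euclidean_space set \<Rightarrow> 'a set" where
  "manifold_boundary n M =
     {x\<in>M. \<not> (\<exists>U V::'a set. openin (top_of_set M) U \<and> x \<in> U \<and>
                 affine V \<and> aff_dim V = int n \<and> U homeomorphic V)}"

section \<open>Regular CW decompositions and barycentric subdivision\<close>

text \<open>Cells are closed cells, as subsets of the ambient Euclidean space. A flag
  \<open>[e\<^sub>0, \<dots>, e\<^sub>r]\<close> of cells, increasing under strict inclusion, is an \<open>r\<close>-simplex of the
  barycentric subdivision with vertices the barycenters in this order; oriented simplicial chains
  are integer functions on flags. The cells of the dual complexes carry formal tags, since the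
  dual cell of \<open>e\<close> and the dual cell of \<open>e\<close> inside the boundary have the same barycenter.\<close>

datatype 'c dual_cell = Dual 'c | Dual_in 'c | Dual_out 'c

record 'a cw_cobordism =
  dimM :: nat
  mfd :: "'a set"
  mfd_in :: "'a set"
  mfd_out :: "'a set"
  cells :: "'a set set"
  cdim :: "'a set \<Rightarrow> nat"
  bmap :: "('a set \<Rightarrow> real) \<Rightarrow> 'a"
  orM :: "'a set list \<Rightarrow> int"
  or_cell :: "'a set \<Rightarrow> 'a set list \<Rightarrow> int"
  or_dual :: "'a set dual_cell \<Rightarrow> 'a set list \<Rightarrow> int"

definition cells_in :: "'a cw_cobordism \<Rightarrow> 'a set set" where
  "cells_in G = {e \<in> cells G. e \<subseteq> mfd_in G}"

definition cells_out :: "'a cw_cobordism \<Rightarrow> 'a set set" where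
  "cells_out G = {e \<in> cells G. e \<subseteq> mfd_out G}"

definition PL_cobordism :: "'a::euclidean_space cw_cobordism \<Rightarrow> bool" where
  "PL_cobordism G \<longleftrightarrow>
     compact_PL_manifold (dimM G) (mfd G) \<and>
     manifold_boundary (dimM G) (mfd G) = mfd_in G \<union> mfd_out G \<and>
     mfd_in G \<inter> mfd_out G = {} \<and> closed (mfd_in G) \<and> closed (mfd_out G)"

text \<open>A closed \<open>k\<close>-cell is a homeomorphic image of a compact convex \<open>k\<close>-dimensional set, and its
  boundary is the image of the relative frontier of that set.\<close>

definition regular_cw :: "'a::euclidean_space cw_cobordism \<Rightarrow> bool" where
  "regular_cw G \<longleftrightarrow>
     finite (cells G) \<and> \<Union>(cells G) = mfd G \<and>
     (\<forall>e\<in>cells G. \<exists>(C::'a set) f g. compact C \<and> convex C \<and> aff_dim C = int (cdim G e) \<and>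
        homeomorphism C e f g \<and>
        f ` rel_frontier C = \<Union>{e'\<in>cells G. e' \<subset> e}) \<and>
     (\<forall>e\<in>cells G. \<forall>e'\<in>cells G. e' \<subset> e \<longrightarrow> cdim G e' < cdim G e) \<and>
     (\<forall>e\<in>cells G. \<forall>e'\<in>cells G. e \<noteq> e' \<longrightarrow>
        (e - \<Union>{c\<in>cells G. c \<subset> e}) \<inter> (e' - \<Union>{c\<in>cells G. c \<subset> e'}) = {}) \<and>
     (\<exists>T. simplicial_complex T \<and> \<Union>T = mfd G \<and> (\<forall>e\<in>cells G. \<exists>T'\<subseteq>T. e = \<Union>T')) \<and>
     \<Union>(cells_in G) = mfd_in G \<and> \<Union>(cells_out G) = mfd_out G"

definition product_type_out :: "'a cw_cobordism \<Rightarrow> bool" where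
  "product_type_out G \<longleftrightarrow>
     (\<forall>e'\<in>cells_out G. \<exists>!e. e \<in> cells G - cells_out G \<and> cdim G e = cdim G e' + 1 \<and> e' \<subset> e)"

definition out_adj :: "'a cw_cobordism \<Rightarrow> 'a set \<Rightarrow> 'a set" where
  "out_adj G e' = (THE e. e \<in> cells G - cells_out G \<and> cdim G e = cdim G e' + 1 \<and> e' \<subset> e)"

text \<open>Geometric realization of the order complex of a set of cells, in barycentric coordinates.
  A barycentric subdivision is a homeomorphism from it to \<open>M\<close> respecting cells.\<close>

definition realization :: "'a set set \<Rightarrow> ('a set \<Rightarrow> real) set" where
  "realization S =
     {t. (\<forall>c. 0 \<le> t c) \<and> {c. t c \<noteq> 0} \<subseteq> S \<and> chain_subset {c. t c \<noteq> 0} \<and>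
         (\<Sum>c | t c \<noteq> 0. t c) = 1}"

definition barycentric_subdivision :: "'a::euclidean_space cw_cobordism \<Rightarrow> bool" where
  "barycentric_subdivision G \<longleftrightarrow>
     (\<exists>g. homeomorphism (realization (cells G)) (mfd G) (bmap G) g) \<and>
     (\<forall>e\<in>cells G. bmap G ` realization {c\<in>cells G. c \<subseteq> e} = e)"

definition barycenter :: "'a cw_cobordism \<Rightarrow> 'a set \<Rightarrow> 'a" where
  "barycenter G e = bmap G (\<lambda>c. if c = e then 1 else 0)"

subsection \<open>Dual cells\<close>

fun star_cells :: "'a cw_cobordism \<Rightarrow> 'a set dual_cell \<Rightarrow> 'a set set" where
  "star_cells G (Dual e) = {c\<in>cells G. e \<subseteq> c}"
| "star_cells G (Dual_in e) = {c\<in>cells_in G. e \<subseteq> c}"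
| "star_cells G (Dual_out e) = {c\<in>cells_out G. e \<subseteq> c}"

definition dual_carrier :: "'a cw_cobordism \<Rightarrow> 'a set dual_cell \<Rightarrow> 'a set" where
  "dual_carrier G c = bmap G ` realization (star_cells G c)"

fun ddim :: "'a cw_cobordism \<Rightarrow> 'a set dual_cell \<Rightarrow> int" where
  "ddim G (Dual e) = int (dimM G) - int (cdim G e)"
| "ddim G (Dual_in e) = int (dimM G) - 1 - int (cdim G e)"
| "ddim G (Dual_out e) = int (dimM G) - 1 - int (cdim G e)"

fun dual_barycenter :: "'a cw_cobordism \<Rightarrow> 'a set dual_cell \<Rightarrow> 'a" where
  "dual_barycenter G (Dual e) = barycenter G e"
| "dual_barycenter G (Dual_in e) = barycenter G e"
| "dual_barycenter G (Dual_out e) = barycenter G e"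

definition dual_complex :: "'a cw_cobordism \<Rightarrow> 'a set dual_cell set" where
  "dual_complex G = Dual ` (cells G - cells_out G) \<union> Dual_in ` cells_in G"

definition facets :: "'a cw_cobordism \<Rightarrow> 'a set \<Rightarrow> 'a set set" where
  "facets G e = {e'\<in>cells G. e' \<subset> e \<and> cdim G e = cdim G e' + 1}"

definition dual_facets :: "'a cw_cobordism \<Rightarrow> 'a set dual_cell \<Rightarrow> 'a set dual_cell set" where
  "dual_facets G c = {c'\<in>dual_complex G. dual_carrier G c' \<subset> dual_carrier G c \<and>
                        ddim G c = ddim G c' + 1}"

subsection \<open>Orientations, incidence and intersection numbers\<close>

definition flags :: "'a set set \<Rightarrow> 'a set list set" where
  "flags S = {F. F \<noteq> [] \<and> set F \<subseteq> S \<and> sorted_wrt (\<subset>) F}"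

definition bdry :: "('b list \<Rightarrow> int) \<Rightarrow> 'b list \<Rightarrow> int" where
  "bdry z H = (\<Sum>(F, i) | z F \<noteq> 0 \<and> i < length F \<and> take i F @ drop (Suc i) F = H.
                 (- 1) ^ i * z F)"

text \<open>\<open>z\<close> is a fundamental cycle of the pure \<open>d\<close>-dimensional complex \<open>K\<close> relative to \<open>L\<close>.
  The empty flag is excluded because simplicial chains are not augmented.\<close>

definition orientation :: "'a set list set \<Rightarrow> 'a set list set \<Rightarrow> int \<Rightarrow> ('a set list \<Rightarrow> int) \<Rightarrow> bool" where
  "orientation K L d z \<longleftrightarrow>
     (\<forall>F\<in>K. \<exists>F'\<in>K. set F \<subseteq> set F' \<and> int (length F') = d + 1) \<and>
     (\<forall>F. \<bar>z F\<bar> = (if F \<in> K \<and> int (length F) = d + 1 then 1 else 0)) \<and>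
     (\<forall>H. H \<noteq> [] \<and> bdry z H \<noteq> 0 \<longrightarrow> H \<in> L)"

text \<open>Simplicial boundary is the outward-normal-first convention. The outgoing boundary carries
  the induced orientation, the incoming one the opposite.\<close>

definition or_out :: "'a cw_cobordism \<Rightarrow> 'a set list \<Rightarrow> int" where
  "or_out G F = (if set F \<subseteq> cells_out G then bdry (orM G) F else 0)"

definition or_in :: "'a cw_cobordism \<Rightarrow> 'a set list \<Rightarrow> int" where
  "or_in G F = (if set F \<subseteq> cells_in G then - bdry (orM G) F else 0)"

text \<open>\<open>[e : e']\<close> for oriented cells with fundamental chains \<open>z\<close>, \<open>z'\<close>: the coefficient of \<open>z'\<close> in
  the boundary of \<open>z\<close>.\<close>

definition incidence :: "('b list \<Rightarrow> int) \<Rightarrow> ('b list \<Rightarrow> int) \<Rightarrow> int" where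
  "incidence z z' = (THE r. \<forall>H. z' H \<noteq> 0 \<longrightarrow> bdry z H = r * z' H)"

text \<open>\<open>e \<cdot> \<kappa>(e) = 1\<close>. The cells meet transversally in the barycenter of \<open>e\<close>: a top simplex
  \<open>F = [\<dots>, e]\<close> of \<open>e\<close> and a top simplex \<open>H = [e, \<dots>]\<close> of \<open>\<kappa>(e)\<close> span the top simplex
  \<open>F @ tl H\<close> of the ambient manifold, and, measured in tangent spaces at the common vertex,
  the orientation of \<open>F\<close> followed by that of \<open>H\<close> is that of \<open>F @ tl H\<close>. The sign of an
  intersection point is the local degree of \<open>(x, y) \<mapsto> x - y\<close> (Dold's convention); this is the
  factor \<open>(-1)^(dim \<kappa>(e))\<close>, with \<open>dim \<kappa>(e) = length H - 1\<close>. It is the normalization in which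
  the intersection pairing obeys \<open>\<partial>x \<cdot> y + (-1)^(dim x) x \<cdot> \<partial>y = 0\<close> away from the boundary,
  and hence in which the dual pairing of cochains, with its comma of degree \<open>-n\<close>, obeys the Koszul
  sign rule with respect to the coboundary.\<close>

definition intersection_one ::
    "('a set list \<Rightarrow> int) \<Rightarrow> ('a set list \<Rightarrow> int) \<Rightarrow> ('a set list \<Rightarrow> int) \<Rightarrow> bool" where
  "intersection_one zM z z' \<longleftrightarrow>
     (\<forall>F H. z F \<noteq> 0 \<and> z' H \<noteq> 0 \<longrightarrow>
        (- 1) ^ (length H - 1) * z F * z' H * zM (F @ tl H) = 1)"

definition oriented :: "'a cw_cobordism \<Rightarrow> bool" where
  "oriented G \<longleftrightarrow>
     orientation (flags (cells G)) (flags (cells_in G \<union> cells_out G)) (int (dimM G)) (orM G) \<and>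
     (\<forall>e\<in>cells G.
        orientation (flags {c\<in>cells G. c \<subseteq> e}) (flags {c\<in>cells G. c \<subset> e})
          (int (cdim G e)) (or_cell G e))"

definition dual_oriented :: "'a cw_cobordism \<Rightarrow> bool" where
  "dual_oriented G \<longleftrightarrow>
     (\<forall>e\<in>cells G.
        orientation (flags (star_cells G (Dual e)))
          (flags {c\<in>cells G. e \<subset> c} \<union> flags {c\<in>cells_in G \<union> cells_out G. e \<subseteq> c})
          (ddim G (Dual e)) (or_dual G (Dual e)) \<and>
        intersection_one (orM G) (or_cell G e) (or_dual G (Dual e))) \<and>
     (\<forall>e\<in>cells_in G.
        orientation (flags (star_cells G (Dual_in e))) (flags {c\<in>cells_in G. e \<subset> c})
          (ddim G (Dual_in e)) (or_dual G (Dual_in e)) \<and>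
        intersection_one (or_in G) (or_cell G e) (or_dual G (Dual_in e))) \<and>
     (\<forall>e\<in>cells_out G.
        orientation (flags (star_cells G (Dual_out e))) (flags {c\<in>cells_out G. e \<subset> c})
          (ddim G (Dual_out e)) (or_dual G (Dual_out e)) \<and>
        intersection_one (or_out G) (or_cell G e) (or_dual G (Dual_out e)))"

definition inc :: "'a cw_cobordism \<Rightarrow> 'a set \<Rightarrow> 'a set \<Rightarrow> int" where
  "inc G e e' = incidence (or_cell G e) (or_cell G e')"

definition dual_inc :: "'a cw_cobordism \<Rightarrow> 'a set dual_cell \<Rightarrow> 'a set dual_cell \<Rightarrow> int" where
  "dual_inc G c c' = incidence (or_dual G c) (or_dual G c')"

text \<open>Sign with which the embedding \<open>X\<^sub>o\<^sub>u\<^sub>t\<^sup>\<or> \<hookrightarrow> X\<^sup>\<or>\<close> maps the oriented cell \<open>\<kappa>\<^sub>o\<^sub>u\<^sub>t(e')\<close>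
  to \<open>\<kappa>(e)\<close>, where \<open>e = out_adj G e'\<close>. In \<open>M\<close> the dual cell \<open>\<kappa>(e')\<close> is the collar prism
  over \<open>\<kappa>\<^sub>o\<^sub>u\<^sub>t(e')\<close> with opposite end \<open>\<kappa>(e)\<close>, and pushing one end of a prism to the other
  preserves orientations iff the ends have opposite incidence numbers in the prism.\<close>

definition out_sign :: "'a cw_cobordism \<Rightarrow> 'a set \<Rightarrow> int" where
  "out_sign G e' =
     - dual_inc G (Dual e') (Dual_out e') * dual_inc G (Dual e') (Dual (out_adj G e'))"

section \<open>Flat bundles and cellular local systems\<close>

text \<open>A flat bundle with fiber \<open>\<real>\<^sup>m\<close>, given by its parallel transport \<open>P\<close> along paths, that is, as a
  representation of the fundamental groupoid, each fiber being identified with \<open>\<real>\<^sup>m\<close> by a choice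
  of basis. \<open>\<mu> x\<close> is the coefficient of the density on the fiber at \<open>x\<close>.\<close>

definition flat_bundle ::
    "'a::euclidean_space set \<Rightarrow> ((real \<Rightarrow> 'a) \<Rightarrow> real^'m^'m) \<Rightarrow> bool" where
  "flat_bundle M P \<longleftrightarrow>
     (\<forall>x\<in>M. P (linepath x x) = mat 1) \<and>
     (\<forall>g g'. homotopic_paths M g g' \<longrightarrow> P g = P g') \<and>
     (\<forall>g g'. path g \<and> path_image g \<subseteq> M \<and> path g' \<and> path_image g' \<subseteq> M \<and>
             pathfinish g = pathstart g' \<longrightarrow> P (g +++ g') = P g' ** P g)"

definition horizontal_density ::
    "'a::euclidean_space set \<Rightarrow> ((real \<Rightarrow> 'a) \<Rightarrow> real^'m^'m) \<Rightarrow> ('a \<Rightarrow> real) \<Rightarrow> bool" where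
  "horizontal_density M P \<mu> \<longleftrightarrow>
     (\<forall>x\<in>M. 0 < \<mu> x) \<and>
     (\<forall>g. path g \<and> path_image g \<subseteq> M \<longrightarrow> \<bar>det (P g)\<bar> * \<mu> (pathfinish g) = \<mu> (pathstart g))"

definition transport_in ::
    "((real \<Rightarrow> 'a::euclidean_space) \<Rightarrow> real^'m^'m) \<Rightarrow> 'a set \<Rightarrow> 'a \<Rightarrow> 'a \<Rightarrow> real^'m^'m" where
  "transport_in P D x y =
     P (SOME g. path g \<and> path_image g \<subseteq> D \<and> pathstart g = x \<and> pathfinish g = y)"

definition dual_bundle :: "((real \<Rightarrow> 'a) \<Rightarrow> real^'m^'m) \<Rightarrow> (real \<Rightarrow> 'a) \<Rightarrow> real^'m^'m" where
  "dual_bundle P g = transpose (matrix_inv (P g))"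

definition cell_transport ::
    "'a::euclidean_space cw_cobordism \<Rightarrow> ((real \<Rightarrow> 'a) \<Rightarrow> real^'m^'m) \<Rightarrow>
     'a set \<Rightarrow> 'a set \<Rightarrow> real^'m^'m" where
  "cell_transport G P e e' = transport_in P e (barycenter G e') (barycenter G e)"

definition dual_transport ::
    "'a::euclidean_space cw_cobordism \<Rightarrow> ((real \<Rightarrow> 'a) \<Rightarrow> real^'m^'m) \<Rightarrow>
     'a set dual_cell \<Rightarrow> 'a set dual_cell \<Rightarrow> real^'m^'m" where
  "dual_transport G P c c' =
     transport_in (dual_bundle P) (dual_carrier G c) (dual_barycenter G c') (dual_barycenter G c)"

section \<open>Differential forms on graded vector spaces\<close>

text \<open>Forms with polynomial coefficients on a graded vector space with coordinates \<open>x\<close> of degree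
  \<open>deg x\<close> form the free graded commutative algebra on the \<open>x\<close> and \<open>\<delta>x\<close>, graded by total degree
  (\<open>\<delta>\<close> has degree 1). Forms are represented in the free associative algebra, and equality of forms is
  \<open>form_eq\<close>, congruence modulo the ideal generated by graded commutators of generators.
  The derivations and substitutions below descend to the quotient when their values on generators
  are homogeneous of the appropriate degree.\<close>

datatype 'x letter = Co 'x | De 'x

datatype 'x word = Word (letters: "'x letter list")

instantiation word :: (type) monoid_add
begin
definition zero_word :: "'a word" where "zero_word = Word []"
definition plus_word :: "'a word \<Rightarrow> 'a word \<Rightarrow> 'a word" where
  "plus_word u v = Word (letters u @ letters v)"
instance by standard (simp_all add: zero_word_def plus_word_def)
end

type_synonym 'x form = "'x word \<Rightarrow>\<^sub>0 real"

definition scal :: "real \<Rightarrow> 'x form" where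
  "scal r = Poly_Mapping.single 0 r"

definition gens :: "'x letter list \<Rightarrow> 'x form" where
  "gens w = Poly_Mapping.single (Word w) 1"

fun letter_deg :: "('x \<Rightarrow> int) \<Rightarrow> 'x letter \<Rightarrow> int" where
  "letter_deg deg (Co x) = deg x"
| "letter_deg deg (De x) = deg x + 1"

definition ksign :: "int \<Rightarrow> real" where
  "ksign d = (if even d then 1 else - 1)"

inductive_set koszul_ideal :: "('x \<Rightarrow> int) \<Rightarrow> 'x form set" for deg where
  zero: "0 \<in> koszul_ideal deg"
| comm: "gens [a, b] - scal (ksign (letter_deg deg a * letter_deg deg b)) * gens [b, a]
           \<in> koszul_ideal deg"
| add: "p \<in> koszul_ideal deg \<Longrightarrow> q \<in> koszul_ideal deg \<Longrightarrow> p + q \<in> koszul_ideal deg"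
| mult: "p \<in> koszul_ideal deg \<Longrightarrow> r * p * s \<in> koszul_ideal deg"

definition form_eq :: "('x \<Rightarrow> int) \<Rightarrow> 'x form \<Rightarrow> 'x form \<Rightarrow> bool" where
  "form_eq deg p q \<longleftrightarrow> p - q \<in> koszul_ideal deg"

text \<open>The derivation of degree \<open>t\<close> with given values on generators.\<close>

definition derivation ::
    "('x \<Rightarrow> int) \<Rightarrow> int \<Rightarrow> ('x letter \<Rightarrow> 'x form) \<Rightarrow> 'x form \<Rightarrow> 'x form" where
  "derivation deg t D p =
     (\<Sum>w\<in>Poly_Mapping.keys p. \<Sum>i<length (letters w).
        scal (Poly_Mapping.lookup p w *
              ksign (t * sum_list (map (letter_deg deg) (take i (letters w))))) *
        gens (take i (letters w)) * D (letters w ! i) * gens (drop (Suc i) (letters w)))"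

definition de_Rham :: "('x \<Rightarrow> int) \<Rightarrow> 'x form \<Rightarrow> 'x form" where
  "de_Rham deg = derivation deg 1 (\<lambda>a. case a of Co x \<Rightarrow> gens [De x] | De x \<Rightarrow> 0)"

text \<open>Contraction with a vector field of degree 1, given by its components \<open>Q x\<close>, has total
  degree \<open>1 - 1 = 0\<close>.\<close>

definition contract :: "('x \<Rightarrow> int) \<Rightarrow> ('x \<Rightarrow> 'x form) \<Rightarrow> 'x form \<Rightarrow> 'x form" where
  "contract deg Q = derivation deg 0 (\<lambda>a. case a of Co x \<Rightarrow> 0 | De x \<Rightarrow> Q x)"

definition apply_vf :: "('x \<Rightarrow> int) \<Rightarrow> ('x \<Rightarrow> 'x form) \<Rightarrow> 'x form \<Rightarrow> 'x form" where
  "apply_vf deg Q f = contract deg Q (de_Rham deg f)"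

text \<open>Pullback along the map whose components in the target coordinates \<open>y\<close> are \<open>f y\<close>.\<close>

definition pullback :: "('x \<Rightarrow> int) \<Rightarrow> ('y \<Rightarrow> 'x form) \<Rightarrow> 'y form \<Rightarrow> 'x form" where
  "pullback deg f p =
     (\<Sum>w\<in>Poly_Mapping.keys p. scal (Poly_Mapping.lookup p w) *
        prod_list (map (\<lambda>a. case a of Co y \<Rightarrow> f y | De y \<Rightarrow> de_Rham deg (f y)) (letters w)))"

section \<open>Fields and superfields\<close>

text \<open>The coordinates on \<open>\<F>\<close> are \<open>AC e \<alpha>\<close> for cells \<open>e\<close> of \<open>X\<close> and \<open>BC c \<alpha>\<close> for cells \<open>c\<close> of
  \<open>X\<^sup>\<or>\<close>; those on \<open>\<F>\<^sub>\<partial>\<close> are \<open>AC e \<alpha>\<close> for boundary cells \<open>e\<close>, and \<open>BC c \<alpha>\<close> for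
  \<open>c = Dual_in e\<close>, \<open>c = Dual_out e\<close>. Here \<open>\<alpha>\<close> indexes a basis of the fiber, respectively
  the dual basis.\<close>

datatype ('c, 'm) coord = AC 'c 'm | BC "'c dual_cell" 'm

fun field_deg :: "'a cw_cobordism \<Rightarrow> ('a set, 'm) coord \<Rightarrow> int" where
  "field_deg G (AC e \<alpha>) = 1 - int (cdim G e)"
| "field_deg G (BC c \<alpha>) = int (dimM G) - 2 - ddim G c"

type_synonym ('a, 'm) fform = "('a set, 'm) coord form"
type_synonym ('a, 'm) a_super = "'a set \<Rightarrow> 'm \<Rightarrow> ('a, 'm) fform"
type_synonym ('a, 'm) b_super = "'a set dual_cell \<Rightarrow> 'm \<Rightarrow> ('a, 'm) fform"

text \<open>\<open>\<phi> :: a_super\<close> stands for \<open>\<Sum>\<^sub>e e\<^sup>* \<phi>\<^sub>e\<close>, with coefficients on the right, and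
  \<open>\<psi> :: b_super\<close> for \<open>\<Sum>\<^sub>c \<psi>\<^sub>c c\<^sup>*\<close>, with coefficients on the left. Hence operators of
  degree \<open>t\<close> on forms pass \<open>e\<^sup>*\<close> in the first case, and \<open>d\<close> passes \<open>\<psi>\<^sub>c\<close> in the second.\<close>

definition A_field :: "('a, 'm) a_super" where
  "A_field = (\<lambda>e \<alpha>. gens [Co (AC e \<alpha>)])"

definition B_field :: "('a, 'm) b_super" where
  "B_field = (\<lambda>c \<alpha>. gens [Co (BC c \<alpha>)])"

definition on_A :: "'a cw_cobordism \<Rightarrow> int \<Rightarrow> (('a, 'm) fform \<Rightarrow> ('a, 'm) fform) \<Rightarrow>
    ('a, 'm) a_super \<Rightarrow> ('a, 'm) a_super" where
  "on_A G t D \<phi> = (\<lambda>e \<alpha>. scal (ksign (t * int (cdim G e))) * D (\<phi> e \<alpha>))"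

definition on_B :: "(('a, 'm) fform \<Rightarrow> ('a, 'm) fform) \<Rightarrow>
    ('a, 'm) b_super \<Rightarrow> ('a, 'm) b_super" where
  "on_B D \<psi> = (\<lambda>c \<alpha>. D (\<psi> c \<alpha>))"

definition d_A :: "'a::euclidean_space cw_cobordism \<Rightarrow> ((real \<Rightarrow> 'a) \<Rightarrow> real^'m^'m) \<Rightarrow>
    ('a, 'm) a_super \<Rightarrow> ('a, 'm) a_super" where
  "d_A G P \<phi> = (\<lambda>e \<alpha>. \<Sum>e'\<in>facets G e. \<Sum>\<beta>\<in>UNIV.
      scal (real_of_int (inc G e e') * cell_transport G P e e' $ \<alpha> $ \<beta>) * \<phi> e' \<beta>)"

text \<open>For \<open>\<psi>\<close> of total degree \<open>t\<close>, so that \<open>\<psi>\<^sub>c\<close> has degree \<open>t - dim c\<close>.\<close>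

definition d_B :: "'a::euclidean_space cw_cobordism \<Rightarrow> ((real \<Rightarrow> 'a) \<Rightarrow> real^'m^'m) \<Rightarrow> int \<Rightarrow>
    ('a, 'm) b_super \<Rightarrow> ('a, 'm) b_super" where
  "d_B G P t \<psi> = (\<lambda>c \<alpha>. \<Sum>c'\<in>dual_facets G c. \<Sum>\<beta>\<in>UNIV.
      scal (ksign (t - ddim G c') * real_of_int (dual_inc G c c') *
            dual_transport G P c c' $ \<alpha> $ \<beta>) * \<psi> c' \<beta>)"

text \<open>With coefficients on the outer sides the comma, of degree \<open>-n\<close>, is never passed, so the
  pairings carry no signs.\<close>

definition pairing :: "'a cw_cobordism \<Rightarrow> ('a, 'm::finite) b_super \<Rightarrow> ('a, 'm) a_super \<Rightarrow>
    ('a, 'm) fform" where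
  "pairing G \<psi> \<phi> = (\<Sum>e\<in>cells G - cells_out G. \<Sum>\<alpha>\<in>UNIV. \<psi> (Dual e) \<alpha> * \<phi> e \<alpha>)"

definition pairing_in :: "'a cw_cobordism \<Rightarrow> ('a, 'm::finite) b_super \<Rightarrow> ('a, 'm) a_super \<Rightarrow>
    ('a, 'm) fform" where
  "pairing_in G \<psi> \<phi> = (\<Sum>e\<in>cells_in G. \<Sum>\<alpha>\<in>UNIV. \<psi> (Dual_in e) \<alpha> * \<phi> e \<alpha>)"

definition pairing_out :: "'a cw_cobordism \<Rightarrow> ('a, 'm::finite) b_super \<Rightarrow> ('a, 'm) a_super \<Rightarrow>
    ('a, 'm) fform" where
  "pairing_out G \<psi> \<phi> = (\<Sum>e\<in>cells_out G. \<Sum>\<alpha>\<in>UNIV. \<psi> (Dual_out e) \<alpha> * \<phi> e \<alpha>)"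

definition omega :: "'a cw_cobordism \<Rightarrow> ('a, 'm::finite) fform" where
  "omega G = pairing G (on_B (de_Rham (field_deg G)) B_field)
                       (on_A G 1 (de_Rham (field_deg G)) A_field)"

text \<open>Restriction to \<open>X\<^sub>i\<^sub>n\<close> and \<open>X\<^sub>i\<^sub>n\<^sup>\<or>\<close> is implicit: \<open>pairing_in\<close> only sees these
  components.\<close>

definition action :: "'a::euclidean_space cw_cobordism \<Rightarrow>
    ((real \<Rightarrow> 'a) \<Rightarrow> real^'m^'m::finite) \<Rightarrow> ('a, 'm) fform" where
  "action G P = pairing G B_field (d_A G P A_field) + pairing_in G B_field A_field"

definition Q_equations :: "'a::euclidean_space cw_cobordism \<Rightarrow>
    ((real \<Rightarrow> 'a) \<Rightarrow> real^'m^'m::finite) \<Rightarrow>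
    (('a set, 'm) coord \<Rightarrow> ('a, 'm) fform) \<Rightarrow> bool" where
  "Q_equations G P Q \<longleftrightarrow>
     (\<forall>e\<in>cells G. \<forall>\<alpha>. form_eq (field_deg G)
        (on_A G 1 (apply_vf (field_deg G) Q) A_field e \<alpha>) (d_A G P A_field e \<alpha>)) \<and>
     (\<forall>c\<in>dual_complex G. \<forall>\<alpha>. form_eq (field_deg G)
        (on_B (apply_vf (field_deg G) Q) B_field c \<alpha>)
        (d_B G P (int (dimM G) - 2) B_field c \<alpha>))"

definition alpha_bdry :: "'a cw_cobordism \<Rightarrow> ('a, 'm::finite) fform" where
  "alpha_bdry G =
     pairing_out G B_field (on_A G 1 (de_Rham (field_deg G)) A_field)
     - pairing_in G (on_B (de_Rham (field_deg G)) B_field) A_field"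

text \<open>The components of \<open>\<pi>\<close> in the coordinates of \<open>\<F>\<^sub>\<partial>\<close>. \<open>BC (Dual e)\<close> is not one of
  these coordinates.\<close>

fun bdry_proj :: "'a::euclidean_space cw_cobordism \<Rightarrow>
    ((real \<Rightarrow> 'a) \<Rightarrow> real^'m^'m::finite) \<Rightarrow> ('a set, 'm) coord \<Rightarrow> ('a, 'm) fform" where
  "bdry_proj G P (AC e \<alpha>) = A_field e \<alpha>"
| "bdry_proj G P (BC (Dual_in e) \<alpha>) = B_field (Dual_in e) \<alpha>"
| "bdry_proj G P (BC (Dual_out e') \<alpha>) =
     (let e = out_adj G e' in
      \<Sum>\<beta>\<in>UNIV. scal (real_of_int (out_sign G e') *
          transport_in (dual_bundle P) e (barycenter G e) (barycenter G e') $ \<alpha> $ \<beta>) *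
        B_field (Dual e) \<beta>)"
| "bdry_proj G P (BC (Dual e) \<alpha>) = 0"

end

theory Submission
  imports Defs
begin

text \<open>Expanding both sides in coordinates without ever reordering factors, the terms containing
  \<open>\<delta>B\<close> agree at once, and the identity reduces to comparing the coefficients of
  \<open>B\<^bsub>\<kappa>(e)\<^esub> \<delta>A\<^bsub>e'\<^esub>\<close> for \<open>e'\<close> a facet of \<open>e\<close>: if \<open>e'\<close> lies in \<open>X - X\<^sub>o\<^sub>u\<^sub>t\<close> the term comes from
  \<open>QB\<close>, and if \<open>e'\<close> lies in \<open>X\<^sub>o\<^sub>u\<^sub>t\<close> then \<open>e\<close> is the unique adjacent cell and the term is the
  outgoing part of \<open>\<alpha>\<^sub>\<partial>\<close>. Two facts enter. The incidence numbers satisfy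
  \<open>[\<kappa>(e') : \<kappa>(e)] = -(-1)^(dim e) [e : e']\<close>, with analogous signs at the boundary. The transports
  in \<open>e\<close> and in \<open>\<kappa>(e')\<close> are dual, since \<open>e\<close>, \<open>\<kappa>(e')\<close> and their intersection are cones.\<close>

section \<open>Incidence numbers of dual cells\<close>

lemma strictly_sorted_eq_upt:
  fixes xs :: "nat list"
  assumes "sorted_wrt (<) xs" "set xs \<subseteq> {a..<b}" "length xs = b - a"
  shows "xs = [a..<b]"
proof -
  have "distinct xs" "sorted xs"
    using assms(1) by (simp_all add: strict_sorted_iff)
  then have "set xs = {a..<b}"
    using assms(2,3) by (intro card_subset_eq) (simp_all add: distinct_card)
  then show ?thesis
    using \<open>distinct xs\<close> \<open>sorted xs\<close> by (intro sorted_distinct_set_unique) simp_all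
qed

text \<open>The labels of \<open>F\<close> run from \<open>a\<close> to \<open>b\<close> and those
  of \<open>H\<close> stop just before \<open>b\<close>. Dropping any vertex but the last would
  leave a gap among the labels.\<close>

lemma remove_nth_eq_top:
  assumes "i < length F" "take i F @ drop (Suc i) F = H"
    and "map d F = [a..<Suc b]" "map d H = [a..<b]"
  shows "i = length H \<and> F = H @ [last F]"
proof -
  have len: "length F = Suc b - a" "length H = b - a"
    using arg_cong[OF assms(3), of length] arg_cong[OF assms(4), of length] by auto
  have "i = length H"
  proof (rule ccontr)
    assume "i \<noteq> length H"
    then have i: "i < length H" using len assms(1) by auto
    have "H ! i = F ! Suc i"
      using i assms(1) len unfolding assms(2)[symmetric] by (simp add: nth_append)
    moreover have "d (H ! i) = a + i" "d (F ! Suc i) = a + Suc i"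
      using arg_cong[OF assms(4), of "\<lambda>l. l ! i"] arg_cong[OF assms(3), of "\<lambda>l. l ! Suc i"] i len
      by (simp_all del: upt_Suc)
    ultimately show False by simp
  qed
  moreover have "length F = Suc (length H)" using len assms(1) \<open>i = length H\<close> by auto
  then have "F = butlast F @ [last F]" "butlast F = take (length H) F"
    by (cases F rule: rev_cases; simp)+
  ultimately show ?thesis using assms(2) \<open>length F = Suc (length H)\<close> by simp
qed

lemma remove_nth_eq_bottom:
  assumes "i < length F" "take i F @ drop (Suc i) F = H"
    and "map d F = [a..<b]" "map d H = [Suc a..<b]"
  shows "i = 0 \<and> F = hd F # H"
proof -
  have len: "length F = b - a" "length H = b - Suc a"
    using arg_cong[OF assms(3), of length] arg_cong[OF assms(4), of length] by auto
  have "i = 0"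
  proof (rule ccontr)
    assume i: "i \<noteq> 0"
    then have "H ! 0 = F ! 0"
      using assms(1) unfolding assms(2)[symmetric] by (simp add: nth_append)
    moreover have "d (H ! 0) = Suc a" "d (F ! 0) = a"
      using arg_cong[OF assms(4), of "\<lambda>l. l ! 0"] arg_cong[OF assms(3), of "\<lambda>l. l ! 0"]
        i len assms(1) by simp_all
    ultimately show False by simp
  qed
  then show ?thesis using assms(1,2) by (cases F) auto
qed

text \<open>All simplices of \<open>z\<close> carry the full range of labels and \<open>H\<close>
  lacks only the top one, so \<open>H\<close> is a face only by deletion of a last vertex, at
  position \<open>length H\<close>. This accounts for the sign.\<close>

lemma bdry_top:
  assumes "\<And>F. z F \<noteq> 0 \<Longrightarrow> map d F = [a..<Suc b]" and "map d H = [a..<b]"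
  shows "bdry z H = (- 1) ^ length H * (\<Sum>c | z (H @ [c]) \<noteq> 0. z (H @ [c]))"
proof -
  have eq: "{(F, i). z F \<noteq> 0 \<and> i < length F \<and> take i F @ drop (Suc i) F = H}
      = (\<lambda>c. (H @ [c], length H)) ` {c. z (H @ [c]) \<noteq> 0}" (is "?L = ?R")
  proof
    show "?L \<subseteq> ?R"
    proof (rule subsetI)
      fix x assume x: "x \<in> ?L"
      then obtain F i where x: "x = (F, i)" and
        *: "z F \<noteq> 0" "i < length F" "take i F @ drop (Suc i) F = H" by blast
      from remove_nth_eq_top[OF *(2,3) assms(1)[OF *(1)] assms(2)]
      have "i = length H" "F = H @ [last F]" by auto
      then show "x \<in> ?R"
        using *(1) unfolding x by (intro image_eqI[of _ _ "last F"]) simp_all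
    qed
  qed auto
  show ?thesis unfolding bdry_def eq
    by (subst sum.reindex) (auto simp: inj_on_def sum_distrib_left)
qed

text \<open>Here the deleted vertex is the first one, at position 0, so no sign appears.\<close>

lemma bdry_bottom:
  assumes "\<And>F. z F \<noteq> 0 \<Longrightarrow> map d F = [a..<b]" and "map d H = [Suc a..<b]"
  shows "bdry z H = (\<Sum>c | z (c # H) \<noteq> 0. z (c # H))"
proof -
  have eq: "{(F, i). z F \<noteq> 0 \<and> i < length F \<and> take i F @ drop (Suc i) F = H}
      = (\<lambda>c. (c # H, 0)) ` {c. z (c # H) \<noteq> 0}" (is "?L = ?R")
  proof
    show "?L \<subseteq> ?R"
    proof (rule subsetI)
      fix x assume x: "x \<in> ?L"
      then obtain F i where x: "x = (F, i)" and
        *: "z F \<noteq> 0" "i < length F" "take i F @ drop (Suc i) F = H" by blast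
      from remove_nth_eq_bottom[OF *(2,3) assms(1)[OF *(1)] assms(2)]
      have "i = 0" "F = hd F # H" by auto
      then show "x \<in> ?R"
        using *(1) unfolding x by (intro image_eqI[of _ _ "hd F"]) simp_all
    qed
  qed auto
  show ?thesis unfolding bdry_def eq
    by (subst sum.reindex) (auto simp: inj_on_def)
qed

text \<open>\<open>incidence\<close> is a definite description; one nonzero value of
  \<open>z'\<close> makes the coefficient unique.\<close>

lemma incidence_eqI:
  assumes "z' H0 \<noteq> 0" and "\<And>H. z' H \<noteq> 0 \<Longrightarrow> bdry z H = r * z' H"
  shows "incidence z z' = r"
  unfolding incidence_def using assms by (intro the_equality) auto

lemma orientation_values:
  assumes "orientation K L d z"
  shows "z F \<noteq> 0 \<longleftrightarrow> F \<in> K \<and> int (length F) = d + 1"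
    and "z F \<noteq> 0 \<Longrightarrow> z F * z F = 1"
proof -
  have a: "\<bar>z F\<bar> = (if F \<in> K \<and> int (length F) = d + 1 then 1 else 0)"
    using assms unfolding orientation_def by auto
  show "z F \<noteq> 0 \<longleftrightarrow> F \<in> K \<and> int (length F) = d + 1" using a by (auto split: if_splits)
  then show "z F \<noteq> 0 \<Longrightarrow> z F * z F = 1" using a
    by (metis abs_mult_self_eq mult_1)
qed

lemma orientation_pure:
  assumes "orientation K L d z" "F \<in> K"
  shows "\<exists>F'. z F' \<noteq> 0 \<and> set F \<subseteq> set F'"
  using assms orientation_values(1)[OF assms(1)] unfolding orientation_def by metis

lemma singleton_flag: "e \<in> S \<Longrightarrow> [e] \<in> flags S"
  by (simp add: flags_def)

lemma flag_mono: "F \<in> flags S \<Longrightarrow> S \<subseteq> T \<Longrightarrow> F \<in> flags T"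
  by (auto simp: flags_def)

lemma flag_append:
  assumes "F \<in> flags S" "K \<in> flags S'" "last F \<subset> hd K"
  shows "F @ K \<in> flags (S \<union> S')"
proof -
  have F: "F \<noteq> []" "sorted_wrt (\<subset>) F" "set F \<subseteq> S"
    and K: "K \<noteq> []" "sorted_wrt (\<subset>) K" "set K \<subseteq> S'" using assms by (auto simp: flags_def)
  have "x \<subset> y" if "x \<in> set F" "y \<in> set K" for x y
  proof -
    have "x \<subseteq> last F" using F(1,2) that(1)
      by (cases F rule: rev_cases) (auto simp: sorted_wrt_append)
    moreover have "hd K \<subseteq> y" using K(1,2) that(2) by (cases K) auto
    ultimately show ?thesis using assms(3) by blast
  qed
  then show ?thesis using F K by (auto simp: flags_def sorted_wrt_append)
qed

section \<open>Top flags of cells and dual cells\<close>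

locale oriented_cells =
  fixes G :: "'a::euclidean_space cw_cobordism"
  assumes regular: "regular_cw G" and orient: "oriented G" and dual_orient: "dual_oriented G"
begin

lemma cdim_less: "e \<in> cells G \<Longrightarrow> e' \<in> cells G \<Longrightarrow> e' \<subset> e \<Longrightarrow> cdim G e' < cdim G e"
  using regular unfolding regular_cw_def by (elim conjE) metis

lemma flag_cdim_sorted:
  assumes "F \<in> flags S" "S \<subseteq> cells G"
  shows "sorted_wrt (<) (map (cdim G) F)"
proof -
  have "sorted_wrt (\<subset>) F" "set F \<subseteq> cells G" using assms by (auto simp: flags_def)
  then show ?thesis unfolding sorted_wrt_map
    using cdim_less sorted_wrt_mono_rel[of F "(\<subset>)" "\<lambda>x y. cdim G x < cdim G y"] by blast
qed

text \<open>Dimensions increase strictly along a flag, and the window from \<open>a\<close> to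
  \<open>b\<close> has exactly as many integers as the flag has cells, so each dimension occurs
  once.\<close>

lemma flag_cdim_eq:
  assumes "F \<in> flags S" "S \<subseteq> cells G" "length F = b - a"
    and "\<And>c. c \<in> S \<Longrightarrow> a \<le> cdim G c \<and> cdim G c < b"
  shows "map (cdim G) F = [a..<b]"
  using assms flag_cdim_sorted[OF assms(1,2)]
  by (intro strictly_sorted_eq_upt) (auto simp: flags_def)

lemma cdim_mono: "e \<in> cells G \<Longrightarrow> e' \<in> cells G \<Longrightarrow> e' \<subseteq> e \<Longrightarrow> cdim G e' \<le> cdim G e"
  using cdim_less[of e e'] by (metis order.order_iff_strict order_refl psubsetI)

lemma cell_orientation:
  assumes "e \<in> cells G"
  shows "orientation (flags {c\<in>cells G. c \<subseteq> e}) (flags {c\<in>cells G. c \<subset> e})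
    (int (cdim G e)) (or_cell G e)"
  using orient assms unfolding oriented_def by blast

lemma mfd_orientation:
  "orientation (flags (cells G)) (flags (cells_in G \<union> cells_out G)) (int (dimM G)) (orM G)"
  using orient unfolding oriented_def by blast

text \<open>A top flag of \<open>e\<close> has \<open>cdim G e + 1\<close> distinct cells and, by
  purity of the complex of \<open>M\<close>, lies in a flag with \<open>dimM G + 1\<close>
  cells.\<close>

lemma cdim_le:
  assumes "e \<in> cells G" shows "cdim G e \<le> dimM G"
proof -
  obtain F where F: "or_cell G e F \<noteq> 0"
    using orientation_pure[OF cell_orientation[OF assms] singleton_flag[of e]] assms by auto
  then have 1: "F \<in> flags {c\<in>cells G. c \<subseteq> e}" "length F = cdim G e + 1"
    using orientation_values(1)[OF cell_orientation[OF assms]] by force+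
  then have "F \<in> flags (cells G)" by (auto intro: flag_mono)
  from orientation_pure[OF mfd_orientation this] obtain F' where
    F': "orM G F' \<noteq> 0" "set F \<subseteq> set F'" by blast
  have 2: "length F' = dimM G + 1"
    using F'(1) orientation_values(1)[OF mfd_orientation] by force
  have "distinct (map (cdim G) F)"
    using flag_cdim_sorted[OF 1(1)] by (simp add: strict_sorted_iff)
  then have "distinct F" by (simp add: distinct_map)
  then have "length F \<le> length F'"
    using F'(2) by (metis card_length card_mono distinct_card finite_set le_trans)
  then show ?thesis using 1 2 by simp
qed

text \<open>A top flag meets every dimension up to that of \<open>e\<close>; its last cell lies in
  \<open>e\<close> and has the same dimension, hence equals \<open>e\<close>.\<close>

lemma or_cell_flag:
  assumes "e \<in> cells G" "or_cell G e F \<noteq> 0"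
  shows "F \<in> flags {c\<in>cells G. c \<subseteq> e}" "map (cdim G) F = [0..<Suc (cdim G e)]" "last F = e"
proof -
  show F: "F \<in> flags {c\<in>cells G. c \<subseteq> e}"
    using assms orientation_values(1)[OF cell_orientation] by blast
  have "length F = Suc (cdim G e)"
    using assms orientation_values(1)[OF cell_orientation] by fastforce
  then show dims: "map (cdim G) F = [0..<Suc (cdim G e)]"
    using cdim_mono[OF assms(1)] by (intro flag_cdim_eq[OF F]) (auto simp: less_Suc_eq_le)
  then have "F \<noteq> []" by auto
  then have "cdim G (last F) = cdim G e" using dims
    by (metis last_map last_upt diff_Suc_1 list.map_disc_iff zero_less_Suc)
  moreover have "last F \<in> cells G" "last F \<subseteq> e"
    using F \<open>F \<noteq> []\<close> last_in_set[of F] unfolding flags_def by blast+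
  ultimately show "last F = e" using cdim_less[OF assms(1), of "last F"] by (metis less_irrefl psubsetI)
qed

lemma or_cell_flagI:
  assumes "e \<in> cells G" "F \<in> flags {c\<in>cells G. c \<subseteq> e}" "length F = Suc (cdim G e)"
  shows "or_cell G e F \<noteq> 0"
  using assms orientation_values(1)[OF cell_orientation] by auto

lemma ex_or_cell: "e \<in> cells G \<Longrightarrow> \<exists>F. or_cell G e F \<noteq> 0"
  using orientation_pure[OF cell_orientation singleton_flag[of e]] by auto

text \<open>The common shape of the top flags of a dual cell in the bulk (\<open>b = n + 1\<close>) or inside a
  boundary component (\<open>b = n\<close>).\<close>

lemma star_flag:
  assumes "orientation (flags {c\<in>S. e \<subseteq> c}) L (int b - 1 - int (cdim G e)) z"
    and "S \<subseteq> cells G" "e \<in> S" "\<And>c. c \<in> S \<Longrightarrow> cdim G c < b" "z H \<noteq> 0"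
  shows "H \<in> flags {c\<in>S. e \<subseteq> c}" "map (cdim G) H = [cdim G e..<b]" "H = e # tl H"
proof -
  show H: "H \<in> flags {c\<in>S. e \<subseteq> c}"
    using assms(1,5) orientation_values(1) by blast
  have lt: "cdim G e < b" using assms(3,4) by blast
  have "int (length H) = int b - int (cdim G e)"
    using assms(1,5) orientation_values(1) by fastforce
  then have "length H = b - cdim G e" using lt by simp
  then show dims: "map (cdim G) H = [cdim G e..<b]"
    using cdim_mono[of _ e] assms(2-4) by (intro flag_cdim_eq[OF H]) auto
  then have "H \<noteq> []" using lt
    by (metis list.map_disc_iff upt_eq_Nil_conv not_le less_imp_neq not_less0 neq0_conv)
  then have "cdim G (hd H) = cdim G e" using dims lt
    by (metis hd_map hd_upt)
  moreover have "hd H \<in> cells G" "e \<subseteq> hd H"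
    using H \<open>H \<noteq> []\<close> hd_in_set[of H] assms(2) unfolding flags_def by blast+
  ultimately have "hd H = e"
    using cdim_less[of "hd H" e] assms(2,3) by (metis less_irrefl psubsetI subsetD)
  then show "H = e # tl H" using \<open>H \<noteq> []\<close> by (cases H) auto
qed

text \<open>The dimension of \<kappa>(e) is written in the form that \<open>star_flag\<close>
  expects, with \<open>b = Suc (dimM G)\<close>.\<close>

lemma dual_orientation:
  assumes "e \<in> cells G"
  shows "orientation (flags {c\<in>cells G. e \<subseteq> c})
          (flags {c\<in>cells G. e \<subset> c} \<union> flags {c\<in>cells_in G \<union> cells_out G. e \<subseteq> c})
          (int (Suc (dimM G)) - 1 - int (cdim G e)) (or_dual G (Dual e))"
    and "intersection_one (orM G) (or_cell G e) (or_dual G (Dual e))"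
  using dual_orient assms unfolding dual_oriented_def by auto

lemma or_dual_flag:
  assumes "e \<in> cells G" "or_dual G (Dual e) H \<noteq> 0"
  shows "H \<in> flags {c\<in>cells G. e \<subseteq> c}" "map (cdim G) H = [cdim G e..<Suc (dimM G)]" "H = e # tl H"
  using star_flag[OF dual_orientation(1)[OF assms(1)] _ assms(1) _ assms(2)] cdim_le
  by (auto simp del: upt_Suc simp: less_Suc_eq_le)

lemma or_dual_flagI:
  assumes "e \<in> cells G" "H \<in> flags {c\<in>cells G. e \<subseteq> c}" "length H = Suc (dimM G) - cdim G e"
  shows "or_dual G (Dual e) H \<noteq> 0"
  using assms orientation_values(1)[OF dual_orientation(1)] cdim_le[OF assms(1)] by auto

lemma ex_or_dual: "e \<in> cells G \<Longrightarrow> \<exists>F. or_dual G (Dual e) F \<noteq> 0"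
  using orientation_pure[OF dual_orientation(1) singleton_flag[of e]] by auto

text \<open>Concatenating a top flag \<open>F\<close> of \<open>e'\<close> with a top flag \<open>K\<close> of \<open>\<kappa>(e)\<close> gives one top flag of
  \<open>M\<close>, whose orientation is computed both from \<open>e \<cdot> \<kappa>(e)\<close> and from \<open>e' \<cdot> \<kappa>(e')\<close>. Comparing
  shows that both incidence numbers are well defined and differ by a sign.\<close>

lemma incidence_facet:
  assumes e: "e \<in> cells G" "e' \<in> facets G e"
  shows "dual_inc G (Dual e') (Dual e) = - ((- 1) ^ cdim G e) * inc G e e'"
proof -
  have e': "e' \<in> cells G" "e' \<subset> e" "cdim G e = Suc (cdim G e')" using e by (auto simp: facets_def)
  let ?z = "or_cell G e" and ?z' = "or_cell G e'"
    and ?w = "or_dual G (Dual e)" and ?w' = "or_dual G (Dual e')"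
  \<comment> \<open>Since \<open>e'\<close> is a facet, putting \<open>e\<close> on top of a top
    flag of \<open>e'\<close> gives a top flag of \<open>e\<close>; dually, \<open>we\<close> puts
    \<open>e'\<close> below a top flag of \<kappa>(e).\<close>
  have ze: "?z (F @ [e]) \<noteq> 0" if F: "?z' F \<noteq> 0" for F
  proof (rule or_cell_flagI[OF e(1)])
    have "F @ [e] \<in> flags ({c\<in>cells G. c \<subseteq> e'} \<union> {e})"
      by (rule flag_append[OF or_cell_flag(1)[OF e'(1) F]])
        (use or_cell_flag(3)[OF e'(1) F] e'(2) in \<open>auto simp: flags_def\<close>)
    then show "F @ [e] \<in> flags {c\<in>cells G. c \<subseteq> e}" using e(1) e'(2) by (auto intro: flag_mono)
    show "length (F @ [e]) = Suc (cdim G e)"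
      using arg_cong[OF or_cell_flag(2)[OF e'(1) F], of length] e'(3) by simp
  qed
  have we: "?w' (e' # K) \<noteq> 0" if K: "?w K \<noteq> 0" for K
  proof (rule or_dual_flagI[OF e'(1)])
    have "hd K = e" using or_dual_flag(3)[OF e(1) K] by (metis list.sel(1))
    then have "[e'] @ K \<in> flags ({e'} \<union> {c\<in>cells G. e \<subseteq> c})"
      by (intro flag_append or_dual_flag(1)[OF e(1) K]) (use e'(2) in \<open>auto simp: flags_def\<close>)
    then show "e' # K \<in> flags {c\<in>cells G. e' \<subseteq> c}" using e(1) e' by (auto intro: flag_mono)
    show "length (e' # K) = Suc (dimM G) - cdim G e'"
      using arg_cong[OF or_dual_flag(2)[OF e(1) K], of length] e'(3) cdim_le[OF e(1)] by simp
  qed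
  have bz: "bdry ?z F = (- 1) ^ cdim G e * ?z (F @ [e])" if F: "?z' F \<noteq> 0" for F
  proof -
    have l: "length F = cdim G e"
      using arg_cong[OF or_cell_flag(2)[OF e'(1) F], of length] e'(3) by simp
    have "{c. ?z (F @ [c]) \<noteq> 0} = {e}" using ze[OF F] or_cell_flag(3)[OF e(1)] by fastforce
    then show ?thesis
      using bdry_top[of ?z "cdim G" 0 "cdim G e" F] or_cell_flag(2)[OF e(1)]
        or_cell_flag(2)[OF e'(1) F] unfolding e'(3)[symmetric] by (simp del: upt_Suc add: l)
  qed
  have bw: "bdry ?w' K = ?w' (e' # K)" if K: "?w K \<noteq> 0" for K
  proof -
    have "{c. ?w' (c # K) \<noteq> 0} = {e'}" using we[OF K] or_dual_flag(3)[OF e'(1)] by fastforce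
    then show ?thesis
      using bdry_bottom[of ?w' "cdim G" "cdim G e'" "Suc (dimM G)" K] or_dual_flag(2)[OF e'(1)]
        or_dual_flag(2)[OF e(1) K] unfolding e'(3)[symmetric] by (simp del: upt_Suc)
  qed
  \<comment> \<open>The ambient simplex \<open>F @ K\<close> is split at \<open>e\<close> in the
    first relation and at \<open>e'\<close> in the second. The exponents \<open>length K - 1\<close>
    and \<open>length K\<close> differ by one, which produces the minus sign.\<close>
  have key: "?z (F @ [e]) * ?z' F = - (?w K * ?w' (e' # K))" if F: "?z' F \<noteq> 0" and K: "?w K \<noteq> 0" for F K
  proof -
    have K': "K = e # tl K" using or_dual_flag(3)[OF e(1) K] .
    have l: "length K = Suc (length K - 1)" using K' by (metis length_Cons diff_Suc_1)
    have 1: "(- 1) ^ (length K - 1) * ?z (F @ [e]) * ?w K * orM G (F @ K) = 1"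
      using dual_orientation(2)[OF e(1)] ze[OF F] K K' unfolding intersection_one_def
      by (metis append.assoc append_Cons append_Nil)
    have 2: "(- 1) ^ length K * ?z' F * ?w' (e' # K) * orM G (F @ K) = 1"
      using dual_orientation(2)[OF e'(1)] we[OF K] F unfolding intersection_one_def
      by (metis diff_Suc_1 length_Cons list.sel(3))
    have 3: "?z' F * ?z' F = 1" "?w K * ?w K = 1"
      using orientation_values(2)[OF cell_orientation[OF e'(1)] F]
        orientation_values(2)[OF dual_orientation(1)[OF e(1)] K] by auto
    define s where "s = (- 1 :: int) ^ (length K - 1)"
    define m where "m = orM G (F @ K)"
    have s: "s * s = 1" "(- 1) ^ length K = - s"
      unfolding s_def by (simp add: power_mult_distrib[symmetric], subst l, simp)
    have "orM G (F @ K) \<noteq> 0" using 1 by (metis mult_zero_right zero_neq_one)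
    then have m: "m * m = 1" using orientation_values(2)[OF mfd_orientation] m_def by simp
    have A: "s * ?z (F @ [e]) * ?w K * m = 1" using 1 by (simp add: s_def m_def)
    have B: "s * ?z' F * ?w' (e' # K) * m = - 1" using 2 s(2) by (simp add: m_def)
    have "?z (F @ [e]) = s * ?w K * m" "?w' (e' # K) = - (s * ?z' F * m)"
      using A B s(1) m 3 by algebra+
    then show ?thesis by (simp add: algebra_simps)
  qed
  obtain F0 K0 where 0: "?z' F0 \<noteq> 0" "?w K0 \<noteq> 0" using ex_or_cell[OF e'(1)] ex_or_dual[OF e(1)] by blast
  \<comment> \<open>In \<open>key\<close> one side depends only on \<open>F\<close> and the other
    only on \<open>K\<close>, so both are constant; \<open>r\<close> is this common value, read off
    on the dual side.\<close>
  define r where "r = ?w K0 * ?w' (e' # K0)"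
  have sqz: "?z' F * ?z' F = 1" if "?z' F \<noteq> 0" for F
    using orientation_values(2)[OF cell_orientation[OF e'(1)] that] .
  have sqw: "?w K * ?w K = 1" if "?w K \<noteq> 0" for K
    using orientation_values(2)[OF dual_orientation(1)[OF e(1)] that] .
  have "inc G e e' = - ((- 1) ^ cdim G e) * r"
    unfolding inc_def
  proof (rule incidence_eqI[where z' = ?z', OF 0(1)])
    fix F assume F: "?z' F \<noteq> 0"
    have "?z (F @ [e]) * ?z' F = - r" using key[OF F 0(2)] r_def by simp
    then have "?z (F @ [e]) = - r * ?z' F" using sqz[OF F] by algebra
    then show "bdry ?z F = - ((- 1) ^ cdim G e) * r * ?z' F"
      using bz[OF F] by simp
  qed
  moreover have "dual_inc G (Dual e') (Dual e) = r"
    unfolding dual_inc_def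
  proof (rule incidence_eqI[where z' = ?w, OF 0(2)])
    fix K assume K: "?w K \<noteq> 0"
    have "?w K * ?w' (e' # K) = r" using key[OF 0(1) 0(2)] key[OF 0(1) K] r_def by simp
    then have "?w' (e' # K) = r * ?w K" using sqw[OF K]
      by (metis mult.assoc mult.commute mult_1)
    then show "bdry ?w' K = r * ?w K" using bw[OF K] by simp
  qed
  ultimately show ?thesis by (simp flip: power_mult_distrib mult.assoc)
qed

section \<open>Incidence of a dual cell with its boundary part\<close>

lemma boundary_cdim_less:
  assumes "orientation (flags {c\<in>S. e \<subseteq> c}) L (int (dimM G) - 1 - int (cdim G e)) z" "e \<in> S"
  shows "cdim G e < dimM G"
proof -
  \<comment> \<open>A top flag is nonempty, so its length, the difference of the two dimensions, is
    positive.\<close>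
  obtain F where "z F \<noteq> 0" using orientation_pure[OF assms(1) singleton_flag[of e]] assms(2) by auto
  then have "F \<noteq> []" "int (length F) = int (dimM G) - int (cdim G e)"
    using orientation_values(1)[OF assms(1), of F] by (auto simp: flags_def)
  then show ?thesis by (cases F) auto
qed

text \<open>For \<open>S\<close> the cells of a boundary component whose orientation is \<open>s\<close> times the induced one.\<close>

lemma incidence_boundary:
  assumes S: "S \<subseteq> cells G" "\<And>c c'. c \<in> S \<Longrightarrow> c' \<in> cells G \<Longrightarrow> c' \<subseteq> c \<Longrightarrow> c' \<in> S"
    and e: "e \<in> S"
    and w: "\<And>e. e \<in> S \<Longrightarrow>
      orientation (flags {c\<in>S. e \<subseteq> c}) (L e) (int (dimM G) - 1 - int (cdim G e)) (w e)"
    and ob: "\<And>F. set F \<subseteq> S \<Longrightarrow> ob F = s * bdry (orM G) F"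
    and i1: "intersection_one ob (or_cell G e) (w e)"
    and s: "s * s = 1"
  shows "incidence (or_dual G (Dual e)) (w e) = - s * (- 1) ^ cdim G e"
proof -
  have lt: "cdim G c < dimM G" if "c \<in> S" for c
    using boundary_cdim_less[OF w[OF that] that] .
  have eG: "e \<in> cells G" using e S by blast
  let ?z = "or_cell G e" and ?w' = "or_dual G (Dual e)" and ?n = "dimM G" and ?d = "cdim G e"
  obtain K0 where K0: "w e K0 \<noteq> 0"
    using orientation_pure[OF w[OF e] singleton_flag[of e]] e by auto
  obtain F where F: "?z F \<noteq> 0" using ex_or_cell[OF eG] by blast
  note Fl = or_cell_flag[OF eG F]
  show ?thesis
  proof (rule incidence_eqI[where z' = "w e", OF K0])
    fix K assume K: "w e K \<noteq> 0"
    note Kl = star_flag[OF w[OF e] S(1) e lt K]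
    have lK: "length K = ?n - ?d" using arg_cong[OF Kl(2), of length] by simp
    have lF: "length F = Suc ?d" using arg_cong[OF Fl(2), of length] by simp
    \<comment> \<open>\<open>F\<close> ends and \<open>K\<close> begins with \<open>e\<close>, so
      the shared vertex may be attributed to either flag.\<close>
    have FtK: "F @ tl K = butlast F @ K"
      using Kl(3) Fl(3) lF
      by (metis append_butlast_last_id append_Cons append_Nil append_assoc list.size(3) nat.distinct(1))
    \<comment> \<open>This flag misses only the dimension \<open>n\<close>, so its coefficient in
      the boundary of \<open>orM G\<close> is given by \<open>bdry_top\<close>.\<close>
    have dF: "map (cdim G) (F @ tl K) = [0..<?n]"
    proof -
      have "map (cdim G) (butlast F) = [0..<?d]" using Fl(2) by (simp add: map_butlast)
      moreover have "[0..<?d] @ [?d..<?n] = [0..<?n]"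
        using lt[OF e] by (metis le_add_diff_inverse less_imp_le_nat upt_add_eq_append zero_le)
      ultimately show ?thesis unfolding FtK using Kl(2) by simp
    qed
    have lFK: "length (F @ tl K) = ?n" using arg_cong[OF dF, of length] by simp
    have "set (F @ tl K) \<subseteq> S"
      using Fl(1) Kl(1,3) S(2)[OF e] list.set_sel(2)[of K] by (cases K) (auto simp: flags_def)
    then have o1: "ob (F @ tl K) = s * bdry (orM G) (F @ tl K)" by (rule ob)
    have dM: "map (cdim G) F' = [0..<Suc ?n]" if "orM G F' \<noteq> 0" for F'
      using that orientation_values(1)[OF mfd_orientation, of F'] cdim_le
      by (intro flag_cdim_eq[of F' "cells G"]) (auto simp: less_Suc_eq_le)
    have b1: "bdry (orM G) (F @ tl K) = (- 1) ^ ?n *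
        (\<Sum>c | orM G (F @ tl K @ [c]) \<noteq> 0. orM G (F @ tl K @ [c]))"
      using bdry_top[OF dM dF] by (simp only: lFK append_assoc)
    have b2: "bdry ?w' K = (- 1) ^ (?n - ?d) * (\<Sum>c | ?w' (K @ [c]) \<noteq> 0. ?w' (K @ [c]))"
      unfolding lK[symmetric] by (rule bdry_top[OF or_dual_flag(2)[OF eG] Kl(2)])
    \<comment> \<open>The same cells \<open>c\<close> complete \<open>F @ tl K\<close> to a top flag
      of \<open>M\<close> and \<open>K\<close> to a top flag of \<kappa>(e); the values are related
      by the normalization of the intersection of \<open>e\<close> with \<kappa>(e).\<close>
    have iff: "orM G (F @ tl K @ [c]) \<noteq> 0 \<longleftrightarrow> ?w' (K @ [c]) \<noteq> 0" (is "?a \<longleftrightarrow> ?b")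
      and val: "?w' (K @ [c]) \<noteq> 0 \<Longrightarrow> orM G (F @ tl K @ [c]) = (- 1) ^ (?n - ?d) * (?z F * ?w' (K @ [c]))" for c
    proof -
      have tl: "tl (K @ [c]) = tl K @ [c]" "length (K @ [c]) - 1 = ?n - ?d"
        using Kl(3) lK by (cases K; simp)+
      have *: "(- 1) ^ (?n - ?d) * ?z F * ?w' (K @ [c]) * orM G (F @ tl K @ [c]) = 1" if ?b
        using dual_orientation(2)[OF eG] F that tl unfolding intersection_one_def by metis
      then show "orM G (F @ tl K @ [c]) = (- 1) ^ (?n - ?d) * (?z F * ?w' (K @ [c]))" if ?b
      proof -
        define r where "r = (- 1::int) ^ (?n - ?d)"
        have "r * r = 1" unfolding r_def by (simp flip: power_mult_distrib)
        moreover have "?z F * ?z F = 1" "?w' (K @ [c]) * ?w' (K @ [c]) = 1"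
          using orientation_values(2)[OF cell_orientation[OF eG] F]
            orientation_values(2)[OF dual_orientation(1)[OF eG] that] by auto
        ultimately show ?thesis using *[OF that] unfolding r_def[symmetric] by algebra
      qed
      show "?a \<longleftrightarrow> ?b"
      proof
        assume ?a
        then have "F @ tl K @ [c] \<in> flags (cells G)"
          using orientation_values(1)[OF mfd_orientation] by blast
        then have "butlast F @ (K @ [c]) \<in> flags (cells G)"
          using FtK by (metis append_assoc)
        then have "sorted_wrt (\<subset>) (K @ [c])" "c \<in> cells G"
          by (auto simp: flags_def sorted_wrt_append)
        moreover have "e \<subseteq> c" using calculation(1) Kl(3) by (cases K) auto
        ultimately have "K @ [c] \<in> flags {c\<in>cells G. e \<subseteq> c}"
          using Kl(1) S(1) by (auto simp: flags_def)
        then show ?b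
          by (rule or_dual_flagI[OF eG]) (use lK lt[OF e] in auto)
      qed (use * in force)
    qed
    have b3: "(\<Sum>c | orM G (F @ tl K @ [c]) \<noteq> 0. orM G (F @ tl K @ [c]))
        = (- 1) ^ (?n - ?d) * ?z F * (\<Sum>c | ?w' (K @ [c]) \<noteq> 0. ?w' (K @ [c]))"
      unfolding iff sum_distrib_left by (rule sum.cong) (auto simp: val)
    have b4: "bdry (orM G) (F @ tl K) = (- 1) ^ ?n * ?z F * bdry ?w' K"
      unfolding b1 b2 b3 by simp
    \<comment> \<open>The normalization inside the boundary, with the boundary orientation rewritten
      by \<open>b4\<close> in terms of the boundary of \<kappa>(e).\<close>
    have b5: "(- 1) ^ (?n - ?d - 1) * ?z F * w e K * (s * ((- 1) ^ ?n * ?z F * bdry ?w' K)) = 1"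
      using i1 F K lK unfolding intersection_one_def by (metis o1 b4)
    \<comment> \<open>The exponents add up to twice \<open>n - d - 1\<close> plus
      \<open>d + 1\<close>.\<close>
    have sg: "(- 1) ^ (?n - ?d - 1) * (- 1) ^ ?n = - ((- 1 :: int) ^ ?d)"
    proof -
      have "?n = (?n - ?d - 1) + Suc ?d" using lt[OF e] by simp
      then have "(- 1 :: int) ^ ?n = (- 1) ^ (?n - ?d - 1) * (- 1) ^ Suc ?d" by (metis power_add)
      then show ?thesis by (simp flip: power_mult_distrib mult.assoc)
    qed
    have zz: "?z F * ?z F = 1" "w e K * w e K = 1"
      using orientation_values(2)[OF cell_orientation[OF eG] F]
        orientation_values(2)[OF w[OF e] K] by auto
    define r where "r = (- 1 :: int) ^ ?d"
    have dd: "r * r = 1" unfolding r_def by (simp flip: power_mult_distrib)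
    have "((- 1) ^ (?n - ?d - 1) * (- 1) ^ ?n) * s * w e K * (?z F * ?z F) * bdry ?w' K = 1"
      using b5 by (simp only: mult_ac)
    then have "- ((- 1) ^ ?d) * s * w e K * bdry ?w' K = 1"
      unfolding sg zz(1) by simp
    then show "bdry ?w' K = - s * (- 1) ^ ?d * w e K"
      using s dd zz(2) unfolding r_def[symmetric] by algebra
  qed
qed

lemma dual_in_orientation:
  assumes "e \<in> cells_in G"
  shows "orientation (flags {c\<in>cells_in G. e \<subseteq> c}) (flags {c\<in>cells_in G. e \<subset> c})
      (int (dimM G) - 1 - int (cdim G e)) (or_dual G (Dual_in e))"
    and "intersection_one (or_in G) (or_cell G e) (or_dual G (Dual_in e))"
  using dual_orient assms unfolding dual_oriented_def by simp_all

lemma dual_out_orientation: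
  assumes "e \<in> cells_out G"
  shows "orientation (flags {c\<in>cells_out G. e \<subseteq> c}) (flags {c\<in>cells_out G. e \<subset> c})
      (int (dimM G) - 1 - int (cdim G e)) (or_dual G (Dual_out e))"
    and "intersection_one (or_out G) (or_cell G e) (or_dual G (Dual_out e))"
  using dual_orient assms unfolding dual_oriented_def by simp_all

text \<open>The incoming boundary carries the opposite of the induced orientation, hence
  \<open>s = - 1\<close>; on the outgoing one \<open>s\<close> is 1.\<close>

lemma incidence_in:
  assumes "e \<in> cells_in G"
  shows "dual_inc G (Dual e) (Dual_in e) = (- 1) ^ cdim G e"
  unfolding dual_inc_def
  by (subst incidence_boundary[where S = "cells_in G" and w = "\<lambda>e. or_dual G (Dual_in e)"
        and s = "- 1" and ob = "or_in G", OF _ _ assms dual_in_orientation(1) _ dual_in_orientation(2)])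
    (use assms in \<open>auto simp: cells_in_def or_in_def\<close>)

lemma incidence_out:
  assumes "e \<in> cells_out G"
  shows "dual_inc G (Dual e) (Dual_out e) = - ((- 1) ^ cdim G e)"
  unfolding dual_inc_def
  by (subst incidence_boundary[where S = "cells_out G" and w = "\<lambda>e. or_dual G (Dual_out e)"
        and s = 1 and ob = "or_out G", OF _ _ assms dual_out_orientation(1) _ dual_out_orientation(2)])
    (use assms in \<open>auto simp: cells_out_def or_out_def\<close>)

end

section \<open>Parallel transport in cells and dual cells\<close>

lemma realization_vertex:
  assumes "e \<in> S"
  shows "(\<lambda>c. if c = e then 1 else 0) \<in> realization S"
  using assms by (auto simp: realization_def chain_subset_def)

lemma realization_mono: "S \<subseteq> T \<Longrightarrow> realization S \<subseteq> realization T"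
  by (auto simp: realization_def)

text \<open>Since \<open>e\<close> is comparable with every cell of \<open>S\<close>, adding
  \<open>e\<close> to a chain gives a chain, so weight may be moved linearly to the vertex
  \<open>e\<close>.\<close>

lemma realization_cone:
  assumes "finite S" "e \<in> S" "\<And>c. c \<in> S \<Longrightarrow> c \<subseteq> e \<or> e \<subseteq> c"
    and t: "t \<in> realization S" and s: "0 \<le> s" "s \<le> 1"
  shows "(\<lambda>c. (1 - s) * t c + s * (if c = e then 1 else 0)) \<in> realization S" (is "?u \<in> _")
proof -
  have supp: "{c. ?u c \<noteq> 0} \<subseteq> insert e {c. t c \<noteq> 0}" by auto
  have t': "\<And>c. 0 \<le> t c" "{c. t c \<noteq> 0} \<subseteq> S" "chain_subset {c. t c \<noteq> 0}" "(\<Sum>c | t c \<noteq> 0. t c) = 1"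
    using t by (auto simp: realization_def)
  have "chain_subset (insert e {c. t c \<noteq> 0})"
    using t'(2,3) assms(3) unfolding chain_subset_def by blast
  then have "chain_subset {c. ?u c \<noteq> 0}"
    using supp unfolding chain_subset_def by blast
  moreover have "(\<Sum>c | ?u c \<noteq> 0. ?u c) = (\<Sum>c\<in>S. ?u c)"
    using supp t'(2) assms(1,2) by (intro sum.mono_neutral_left) auto
  moreover have "(\<Sum>c\<in>S. t c) = 1"
    using t'(2,4) assms(1) by (subst sum.mono_neutral_cong_right[of S "{c. t c \<noteq> 0}" _ t]) auto
  then have "(\<Sum>c\<in>S. ?u c) = 1"
    using assms(1,2) by (simp add: sum.distrib flip: sum_distrib_left)
  ultimately show ?thesis
    using t'(1) s supp t'(2) assms(2) by (auto simp: realization_def)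
qed

text \<open>The straight-line contraction to the apex \<open>e\<close> in barycentric coordinates is
  transported by the homeomorphism.\<close>

lemma contractible_cone_image:
  fixes f :: "('a set \<Rightarrow> real) \<Rightarrow> 'a::euclidean_space"
  assumes S: "finite S" "e \<in> S" "\<And>c. c \<in> S \<Longrightarrow> c \<subseteq> e \<or> e \<subseteq> c"
    and hom: "homeomorphism T M f g" and sub: "realization S \<subseteq> T"
  shows "contractible (f ` realization S)"
proof -
  let ?R = "realization S" and ?v = "\<lambda>c. if c = e then 1 else (0::real)"
  \<comment> \<open>In barycentric coordinates \<open>h\<close> moves from the point
    \<open>g x\<close> at \<open>s = 0\<close> to the apex at \<open>s = 1\<close>.\<close>
  define h where "h = (\<lambda>(s, x) c. (1 - s) * g x c + s * ?v c)"
  have R: "f ` ?R \<subseteq> M" using hom sub by (auto simp: homeomorphism_def)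
  have g: "g x \<in> ?R" "f (g x) = x" if "x \<in> f ` ?R" for x
    using that hom sub unfolding homeomorphism_def by auto
  have gc: "continuous_on (f ` ?R) g"
    using hom R continuous_on_subset by (auto simp: homeomorphism_def)
  have hR: "h (s, x) \<in> ?R" if "0 \<le> s" "s \<le> 1" "x \<in> f ` ?R" for s x
    using realization_cone[OF S(1,2) S(3) g(1)[OF that(3)] that(1,2)] unfolding h_def by simp
  have "continuous_on ({0..1} \<times> f ` ?R) h"
  \<comment> \<open>Functions on cells carry the product topology, so continuity is checked in each
    coordinate.\<close>
  proof (rule continuous_on_coordinatewise_then_product)
    fix c
    have "continuous_on (f ` ?R) (\<lambda>x. g x c)"
      by (rule continuous_on_product_then_coordinatewise[OF gc])
    then have "continuous_on ({0..1} \<times> f ` ?R) (\<lambda>p. g (snd p) c)"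
      by (rule continuous_on_compose2) (auto intro!: continuous_intros)
    then show "continuous_on ({0..1} \<times> f ` ?R) (\<lambda>p. h p c)"
      unfolding h_def case_prod_beta by (intro continuous_intros)
  qed
  then have "continuous_on ({0..1} \<times> f ` ?R) (f \<circ> h)"
    by (rule continuous_on_compose, rule_tac continuous_on_subset[OF homeomorphism_cont1[OF hom]])
      (use hR sub in auto)
  moreover have "h (0, x) = g x" "h (1, x) = ?v" for x by (auto simp: h_def)
  ultimately have "homotopic_with_canon (\<lambda>x. True) (f ` ?R) (f ` ?R) id (\<lambda>x. f ?v)"
    using hR g(2)
    by (subst homotopic_with) (auto simp: prod_topology_subtopology_eu intro!: exI[of _ "f \<circ> h"])
  then show ?thesis unfolding contractible_def by blast
qed

section \<open>Parallel transport in simply connected sets\<close>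

lemma matrix_inv_eqI:
  fixes A B :: "'b::semiring_1^'m^'m::finite"
  assumes "A ** B = mat 1" "B ** A = mat 1"
  shows "matrix_inv A = B"
proof -
  \<comment> \<open>\<open>matrix_inv\<close> is chosen by \<open>SOME\<close>; the existence of
    \<open>B\<close> guarantees that the choice is an inverse.\<close>
  have "A ** matrix_inv A = mat 1"
    using assms unfolding matrix_inv_def by (metis (mono_tags, lifting) someI)
  then have "B ** (A ** matrix_inv A) = B" by simp
  then show ?thesis using assms(2) by (simp add: matrix_mul_assoc)
qed

text \<open>A path followed by its reverse is homotopic to a constant path, whose transport is
  trivial.\<close>

lemma flat_bundle_inverse:
  assumes "flat_bundle M P" "path g" "path_image g \<subseteq> M"
  shows "P (reversepath g) ** P g = mat 1"
proof -
  have rp: "path (reversepath g)" "path_image (reversepath g) \<subseteq> M" using assms by auto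
  have "P (reversepath g) ** P g = P (g +++ reversepath g)"
    using assms rp unfolding flat_bundle_def by auto
  also have "\<dots> = P (linepath (pathstart g) (pathstart g))"
    using assms homotopic_paths_rinv[of g M] unfolding flat_bundle_def by blast
  also have "\<dots> = mat 1"
    using assms pathstart_in_path_image[of g] unfolding flat_bundle_def by blast
  finally show ?thesis .
qed

text \<open>Paths in \<open>D\<close> with common ends are homotopic, so the choice made in
  \<open>transport_in\<close> is immaterial. Only homotopy invariance of \<open>P\<close> is
  assumed, so that the dual bundle is covered too.\<close>

lemma transport_in_eq:
  fixes D :: "'a::euclidean_space set"
  assumes "simply_connected D" "D \<subseteq> M" "\<And>g g'. homotopic_paths M g g' \<Longrightarrow> P g = P g'"
    and "path g" "path_image g \<subseteq> D" "pathstart g = x" "pathfinish g = y"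
  shows "transport_in P D x y = P g"
proof -
  let ?C = "\<lambda>g. path g \<and> path_image g \<subseteq> D \<and> pathstart g = x \<and> pathfinish g = y"
  have "?C (SOME g. ?C g)" using assms by (intro someI[of ?C g]) simp
  then have "homotopic_paths D (SOME g. ?C g) g"
    using assms unfolding simply_connected_eq_homotopic_paths by auto
  then show ?thesis unfolding transport_in_def
    using assms homotopic_paths_subset by blast
qed

text \<open>One path in \<open>D \<inter> D'\<close> computes both sides. On the dual side it is run
  backwards, and this reversal cancels the inverse in \<open>dual_bundle\<close>, leaving the
  transpose.\<close>

lemma transport_in_dual:
  fixes P :: "(real \<Rightarrow> 'a::euclidean_space) \<Rightarrow> real^'m^'m::finite"
  assumes P: "flat_bundle M P" and D: "simply_connected D" "D \<subseteq> M" and D': "simply_connected D'" "D' \<subseteq> M"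
    and C: "path_connected (D \<inter> D')" "x \<in> D \<inter> D'" "y \<in> D \<inter> D'"
  shows "transport_in (dual_bundle P) D y x = transpose (transport_in P D' x y)"
proof -
  obtain g where g: "path g" "path_image g \<subseteq> D \<inter> D'" "pathstart g = x" "pathfinish g = y"
    using C unfolding path_connected_def by blast
  have hom: "P p = P q" if "homotopic_paths M p q" for p q
    using P that unfolding flat_bundle_def by blast
  have "matrix_inv (P (reversepath g)) = P g"
  proof (rule matrix_inv_eqI)
    show "P g ** P (reversepath g) = mat 1"
      using flat_bundle_inverse[OF P, of "reversepath g"] g D by auto
    show "P (reversepath g) ** P g = mat 1"
      using flat_bundle_inverse[OF P, of g] g D by auto
  qed
  then have "dual_bundle P (reversepath g) = transpose (P g)"
    by (simp add: dual_bundle_def)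
  moreover have "transport_in P D' x y = P g"
    using g by (intro transport_in_eq[OF D' hom]) auto
  moreover have "dual_bundle P p = dual_bundle P q" if "homotopic_paths M p q" for p q
    using hom[OF that] by (simp add: dual_bundle_def)
  then have "transport_in (dual_bundle P) D y x = dual_bundle P (reversepath g)"
    using g by (intro transport_in_eq[OF D]) auto
  ultimately show ?thesis by simp
qed

section \<open>Cells and dual cells as images of order complexes\<close>

locale subdivided_cells =
  fixes G :: "'a::euclidean_space cw_cobordism"
  assumes finite_cells: "finite (cells G)"
    and subdivision: "barycentric_subdivision G"
begin

lemma bmap_inj: "inj_on (bmap G) (realization (cells G))"
proof -
  obtain g where "homeomorphism (realization (cells G)) (mfd G) (bmap G) g"
    using subdivision unfolding barycentric_subdivision_def by blast
  then show ?thesis unfolding homeomorphism_def by (metis inj_on_inverseI)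
qed

lemma star_cells_subset: "star_cells G c \<subseteq> cells G"
  by (cases c) (auto simp: cells_in_def cells_out_def)

lemma cell_eq: "e \<in> cells G \<Longrightarrow> bmap G ` realization {c\<in>cells G. c \<subseteq> e} = e"
  using subdivision unfolding barycentric_subdivision_def by blast

lemma image_mfd: "S \<subseteq> cells G \<Longrightarrow> bmap G ` realization S \<subseteq> mfd G"
  using subdivision realization_mono[of S "cells G"] unfolding barycentric_subdivision_def
  by (fastforce simp: homeomorphism_def)

lemma barycenter_mem: "e \<in> S \<Longrightarrow> barycenter G e \<in> bmap G ` realization S"
  unfolding barycenter_def by (intro imageI realization_vertex)

lemma cell_nonempty: "e \<in> cells G \<Longrightarrow> e \<noteq> {}"
  using barycenter_mem[of e "{c\<in>cells G. c \<subseteq> e}"] cell_eq by auto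

lemma contractible_image:
  assumes "S \<subseteq> cells G" "e \<in> S" "\<And>c. c \<in> S \<Longrightarrow> c \<subseteq> e \<or> e \<subseteq> c"
  shows "contractible (bmap G ` realization S)"
  using subdivision contractible_cone_image[OF _ assms(2,3), of "realization (cells G)" "mfd G" "bmap G"]
    realization_mono[OF assms(1)] finite_subset[OF assms(1) finite_cells]
  unfolding barycentric_subdivision_def by blast

text \<open>Injectivity of \<open>bmap\<close> reduces inclusion of carriers to inclusion of
  realizations, whose vertices recover the cells of the star.\<close>

lemma dual_carrier_subset_iff:
  "dual_carrier G c \<subseteq> dual_carrier G c' \<longleftrightarrow> star_cells G c \<subseteq> star_cells G c'"
proof
  assume "dual_carrier G c \<subseteq> dual_carrier G c'"
  then have sub: "realization (star_cells G c) \<subseteq> realization (star_cells G c')"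
    unfolding dual_carrier_def using star_cells_subset
    by (subst (asm) inj_on_image_subset_iff[OF bmap_inj]) (auto intro!: realization_mono)
  show "star_cells G c \<subseteq> star_cells G c'"
  proof
    fix e assume "e \<in> star_cells G c"
    from realization_vertex[OF this] have "(\<lambda>c. if c = e then 1 else 0) \<in> realization (star_cells G c')"
      using sub by blast
    then show "e \<in> star_cells G c'" by (auto simp: realization_def split: if_splits)
  qed
qed (auto simp: dual_carrier_def dest: realization_mono)

lemma dual_carrier_psubset_iff:
  "dual_carrier G c \<subset> dual_carrier G c' \<longleftrightarrow> star_cells G c \<subset> star_cells G c'"
  unfolding psubset_eq using dual_carrier_subset_iff by (metis subset_antisym order_refl)

text \<open>A cell and the dual cell of one of its faces \<open>e'\<close> meet in the image of the flags between
  \<open>e'\<close> and \<open>e\<close>, which is a cone; the two transports therefore agree.\<close>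

lemma dual_transport_eq:
  assumes P: "flat_bundle (mfd G) P" and e: "e \<in> cells G" "e' \<in> cells G" "e' \<subseteq> e"
  shows "dual_transport G P (Dual e') (Dual e) = transpose (cell_transport G P e e')"
proof -
  let ?A = "{c\<in>cells G. e' \<subseteq> c}" and ?B = "{c\<in>cells G. c \<subseteq> e}"
  have 1: "contractible (bmap G ` realization ?A)" "contractible (bmap G ` realization ?B)"
    "contractible (bmap G ` realization (?A \<inter> ?B))"
    using e by (intro contractible_image[of _ e'] contractible_image[of _ e]; auto)+
  have "bmap G ` realization ?A \<inter> bmap G ` realization ?B
      = bmap G ` (realization ?A \<inter> realization ?B)"
    by (rule inj_on_image_Int[OF bmap_inj, symmetric]; rule realization_mono) auto
  also have "realization ?A \<inter> realization ?B = realization (?A \<inter> ?B)"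
    by (auto simp: realization_def)
  finally have int: "bmap G ` realization ?A \<inter> bmap G ` realization ?B = bmap G ` realization (?A \<inter> ?B)" .
  have "transport_in (dual_bundle P) (bmap G ` realization ?A) (barycenter G e) (barycenter G e') =
      transpose (transport_in P (bmap G ` realization ?B) (barycenter G e') (barycenter G e))"
    using 1 e by (intro transport_in_dual[OF P])
      (auto intro!: contractible_imp_simply_connected image_mfd barycenter_mem
        contractible_imp_path_connected simp: int)
  then show ?thesis
    by (simp add: dual_transport_def cell_transport_def dual_carrier_def cell_eq[OF e(1)])
qed

text \<open>This serves \<open>bdry_proj\<close>, where the transport to the outgoing boundary runs
  inside the cell \<open>e\<close> instead of a dual cell.\<close>

lemma cell_dual_transport_eq:
  assumes P: "flat_bundle (mfd G) P" and e: "e \<in> cells G" "e' \<in> cells G" "e' \<subseteq> e"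
  shows "transport_in (dual_bundle P) e (barycenter G e) (barycenter G e') =
    transpose (cell_transport G P e e')"
proof -
  let ?B = "{c\<in>cells G. c \<subseteq> e}"
  have c: "contractible e" using contractible_image[of ?B e] e cell_eq by auto
  have "e \<subseteq> mfd G" using image_mfd[of ?B] cell_eq[OF e(1)] by auto
  moreover have "barycenter G e' \<in> e" "barycenter G e \<in> e"
    using barycenter_mem[of _ ?B] cell_eq[OF e(1)] e by auto
  ultimately show ?thesis unfolding cell_transport_def
    using c by (intro transport_in_dual[OF P])
     (auto intro!: contractible_imp_simply_connected contractible_imp_path_connected)
qed

text \<open>Both dual cells have the same barycenter, so the constant path computes the
  transport.\<close>

lemma dual_transport_in:
  fixes P :: "(real \<Rightarrow> 'a) \<Rightarrow> real^'m^'m::finite"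
  assumes P: "flat_bundle (mfd G) P" and e: "e \<in> cells G"
  shows "dual_transport G P (Dual e) (Dual_in e) = mat 1"
proof -
  let ?A = "{c\<in>cells G. e \<subseteq> c}" and ?x = "barycenter G e"
  have x: "?x \<in> bmap G ` realization ?A" using e by (intro barycenter_mem) auto
  have M: "bmap G ` realization ?A \<subseteq> mfd G" by (rule image_mfd) auto
  have "dual_transport G P (Dual e) (Dual_in e) = dual_bundle P (linepath ?x ?x)"
    unfolding dual_transport_def dual_carrier_def
  proof (rule transport_in_eq[of _ "mfd G"])
    show "simply_connected (bmap G ` realization (star_cells G (Dual e)))"
      using contractible_image[of ?A e] e by (auto intro: contractible_imp_simply_connected)
    show "dual_bundle P g = dual_bundle P g'" if "homotopic_paths (mfd G) g g'" for g g'
      using P that unfolding flat_bundle_def dual_bundle_def by metis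
  qed (use M x in auto)
  also have "P (linepath ?x ?x) = mat 1"
    using P M x unfolding flat_bundle_def by blast
  then have "dual_bundle P (linepath ?x ?x) = mat 1"
    using matrix_inv_eqI[of "mat 1 :: real^'m^'m" "mat 1"] by (simp add: dual_bundle_def transpose_mat)
  finally show ?thesis .
qed

end

section \<open>Calculus of differential forms\<close>

lemma scal_mult: "scal a * scal b = scal (a * b)"
  by (simp add: scal_def mult_single)

lemma scal_add: "scal (a + b) = scal a + scal b"
  by (simp add: scal_def single_add)

lemma scal_0 [simp]: "scal 0 = 0"
  by (simp add: scal_def)

lemma scal_1 [simp]: "scal 1 = 1"
  by (simp add: scal_def)

lemma scal_minus: "scal (- r) = - scal r"
  using scal_add[of r "- r"] by (simp add: eq_neg_iff_add_eq_0 add.commute)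

lemma gens_mult: "gens u * gens v = gens (u @ v)"
  by (simp add: gens_def mult_single plus_word_def)

lemma gens_Nil [simp]: "gens [] = 1"
  by (simp add: gens_def flip: zero_word_def)

lemma form_sum_monomials:
  "p = (\<Sum>w\<in>Poly_Mapping.keys p. Poly_Mapping.single w (Poly_Mapping.lookup p w))"
  by (rule poly_mapping_eqI)
    (auto simp: lookup_sum lookup_single when_def not_in_keys_iff_lookup_eq_zero sum.delta)

text \<open>A scalar is a multiple of the empty word and thus commutes with every monomial.\<close>

lemma scal_central: "p * scal r = scal r * p"
  by (subst (1 2) form_sum_monomials[of p])
    (simp add: scal_def sum_distrib_left sum_distrib_right mult_single mult.commute)

lemma scal_left_commute: "p * (scal r * q) = scal r * (p * q)"
  by (metis mult.assoc scal_central)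

lemma scal_scal: "scal a * (scal b * p) = scal (a * b) * p"
  by (metis mult.assoc scal_mult)

text \<open>Common shape of \<open>derivation\<close> and \<open>pullback\<close>, so that linearity
  is proved once for both.\<close>

definition linear_ext :: "('x word \<Rightarrow> 'y form) \<Rightarrow> 'x form \<Rightarrow> 'y form" where
  "linear_ext g p = (\<Sum>w\<in>Poly_Mapping.keys p. scal (Poly_Mapping.lookup p w) * g w)"

lemma linear_ext_superset:
  assumes "finite S" "Poly_Mapping.keys p \<subseteq> S"
  shows "linear_ext g p = (\<Sum>w\<in>S. scal (Poly_Mapping.lookup p w) * g w)"
  unfolding linear_ext_def using assms
  by (intro sum.mono_neutral_left) (auto simp: not_in_keys_iff_lookup_eq_zero)

lemma linear_ext_add: "linear_ext g (p + q) = linear_ext g p + linear_ext g q"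
proof -
  let ?S = "Poly_Mapping.keys p \<union> Poly_Mapping.keys q"
  have "linear_ext g r = (\<Sum>w\<in>?S. scal (Poly_Mapping.lookup r w) * g w)"
    if "r \<in> {p, q, p + q}" for r
    using that keys_add[of p q] by (intro linear_ext_superset) auto
  then show ?thesis by (simp add: lookup_add scal_add algebra_simps sum.distrib)
qed

lemma linear_ext_single: "linear_ext g (Poly_Mapping.single w r) = scal r * g w"
  by (subst linear_ext_superset[of "{w}"]) auto

lemma linear_ext_0: "linear_ext g 0 = 0"
  by (simp add: linear_ext_def)

lemma linear_ext_sum: "linear_ext g (\<Sum>i\<in>I. p i) = (\<Sum>i\<in>I. linear_ext g (p i))"
  by (induction I rule: infinite_finite_induct) (simp_all add: linear_ext_0 linear_ext_add)

lemma linear_ext_scal: "linear_ext g (scal r * p) = scal r * linear_ext g p"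
proof -
  have "scal r * p = (\<Sum>w\<in>Poly_Mapping.keys p. Poly_Mapping.single w (r * Poly_Mapping.lookup p w))"
    by (subst form_sum_monomials[of p]) (simp add: scal_def sum_distrib_left mult_single)
  then show ?thesis
    by (simp add: linear_ext_sum linear_ext_single)
      (simp add: linear_ext_def sum_distrib_left scal_scal)
qed

lemma linear_ext_diff: "linear_ext g (p - q) = linear_ext g p - linear_ext g q"
  using linear_ext_add[of g "p - q" q] by simp

lemma linear_ext_gens: "linear_ext g (gens w) = g (Word w)"
  by (simp add: gens_def linear_ext_single)

lemma derivation_linear_ext:
  "derivation deg t D = linear_ext (\<lambda>w. \<Sum>i<length (letters w).
     scal (ksign (t * sum_list (map (letter_deg deg) (take i (letters w))))) *
        gens (take i (letters w)) * D (letters w ! i) * gens (drop (Suc i) (letters w)))"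
  unfolding derivation_def linear_ext_def fun_eq_iff
  by (simp add: sum_distrib_left mult.assoc scal_scal)

lemma pullback_linear_ext:
  "pullback deg f = linear_ext (\<lambda>w. prod_list
     (map (\<lambda>a. case a of Co y \<Rightarrow> f y | De y \<Rightarrow> de_Rham deg (f y)) (letters w)))"
  unfolding pullback_def linear_ext_def fun_eq_iff by simp

lemma derivation_add: "derivation deg t D (p + q) = derivation deg t D p + derivation deg t D q"
  unfolding derivation_linear_ext by (rule linear_ext_add)

lemma derivation_sum: "derivation deg t D (\<Sum>i\<in>I. p i) = (\<Sum>i\<in>I. derivation deg t D (p i))"
  unfolding derivation_linear_ext by (rule linear_ext_sum)

lemma derivation_scal: "derivation deg t D (scal r * p) = scal r * derivation deg t D p"
  unfolding derivation_linear_ext by (rule linear_ext_scal)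

lemma ksign_0 [simp]: "ksign 0 = 1"
  by (simp add: ksign_def)

lemma derivation_gens1: "derivation deg t D (gens [a]) = D a"
  by (simp add: derivation_linear_ext linear_ext_gens)

text \<open>The action, \<open>omega\<close> and \<open>alpha_bdry\<close> are quadratic in the
  generators, so words of length at most two suffice for the Leibniz rule.\<close>

lemma derivation_gens2:
  "derivation deg t D (gens [a, b]) =
    D a * gens [b] + scal (ksign (t * letter_deg deg a)) * (gens [a] * D b)"
  by (simp add: derivation_linear_ext linear_ext_gens lessThan_Suc mult.assoc add.commute)

section \<open>Congruence modulo the Koszul ideal\<close>

lemma form_eq_refl: "form_eq deg p p"
  by (simp add: form_eq_def koszul_ideal.zero)

lemma form_eq_add: "form_eq deg p q \<Longrightarrow> form_eq deg p' q' \<Longrightarrow> form_eq deg (p + p') (q + q')"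
  unfolding form_eq_def using koszul_ideal.add[of "p - q" deg "p' - q'"] by (simp add: algebra_simps)

lemma form_eq_mult: "form_eq deg p q \<Longrightarrow> form_eq deg (r * p * s) (r * q * s)"
  unfolding form_eq_def using koszul_ideal.mult[of "p - q" deg r s] by (simp add: algebra_simps)

lemma form_eq_sym: "form_eq deg p q \<Longrightarrow> form_eq deg q p"
  unfolding form_eq_def using koszul_ideal.mult[of "p - q" deg "- 1" 1] by (simp add: algebra_simps)

lemma form_eq_sum:
  "(\<And>i. i \<in> I \<Longrightarrow> form_eq deg (p i) (q i)) \<Longrightarrow> form_eq deg (\<Sum>i\<in>I. p i) (\<Sum>i\<in>I. q i)"
  by (induction I rule: infinite_finite_induct) (simp_all add: form_eq_refl form_eq_add)

section \<open>Variation of the action\<close>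

text \<open>As a rewrite rule this terminates, in contrast to \<open>scal_left_commute\<close>.\<close>

lemma gens_scal_left_commute: "gens u * (scal r * q) = scal r * (gens u * q)"
  by (rule scal_left_commute)

lemma de_Rham_Co [simp]: "de_Rham deg (gens [Co x]) = gens [De x]"
  by (simp add: de_Rham_def derivation_gens1)

lemma de_Rham_product:
  "de_Rham deg (gens [Co x] * gens [Co y]) =
    gens [De x] * gens [Co y] + scal (ksign (deg x)) * (gens [Co x] * gens [De y])"
  by (simp add: gens_mult de_Rham_def derivation_gens2)

text \<open>Contraction has total degree 0, so it passes the first factor without a sign.\<close>

lemma contract_product:
  "contract deg Q (gens [De x] * gens [De y]) = Q x * gens [De y] + gens [De x] * Q y"
  by (simp add: gens_mult contract_def derivation_gens2)

lemma pullback_diff: "pullback deg f (p - q) = pullback deg f p - pullback deg f q"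
  unfolding pullback_linear_ext by (rule linear_ext_diff)

lemma pullback_sum: "pullback deg f (\<Sum>i\<in>I. p i) = (\<Sum>i\<in>I. pullback deg f (p i))"
  unfolding pullback_linear_ext by (rule linear_ext_sum)

lemma pullback_scal: "pullback deg f (scal r * p) = scal r * pullback deg f p"
  unfolding pullback_linear_ext by (rule linear_ext_scal)

lemma pullback_gens2:
  "pullback deg f (gens [a, b]) =
    (case a of Co y \<Rightarrow> f y | De y \<Rightarrow> de_Rham deg (f y)) *
    (case b of Co y \<Rightarrow> f y | De y \<Rightarrow> de_Rham deg (f y))"
  by (simp add: pullback_linear_ext linear_ext_gens)

section \<open>The forms as sums over cells and their facets\<close>

locale cobordism_cells = oriented_cells G + subdivided_cells G
  for G :: "'a::euclidean_space cw_cobordism" +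
  fixes P :: "(real \<Rightarrow> 'a) \<Rightarrow> real^'m^'m::finite"
  assumes flat: "flat_bundle (mfd G) P" and product: "product_type_out G"
    and disjoint: "mfd_in G \<inter> mfd_out G = {}"
begin

abbreviation (input) deg :: "('a set, 'm) coord \<Rightarrow> int" where "deg \<equiv> field_deg G"
abbreviation (input) bulk :: "'a set set" where "bulk \<equiv> cells G - cells_out G"
abbreviation (input) b :: "'a set dual_cell \<Rightarrow> 'm \<Rightarrow> ('a, 'm) fform"
  where "b c \<alpha> \<equiv> gens [Co (BC c \<alpha>)]"
abbreviation (input) db :: "'a set dual_cell \<Rightarrow> 'm \<Rightarrow> ('a, 'm) fform"
  where "db c \<alpha> \<equiv> gens [De (BC c \<alpha>)]"
abbreviation (input) a :: "'a set \<Rightarrow> 'm \<Rightarrow> ('a, 'm) fform"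
  where "a e \<alpha> \<equiv> gens [Co (AC e \<alpha>)]"
abbreviation (input) da :: "'a set \<Rightarrow> 'm \<Rightarrow> ('a, 'm) fform"
  where "da e \<alpha> \<equiv> gens [De (AC e \<alpha>)]"

text \<open>The part of \<delta>S in which B on \<kappa>(e) meets \<delta>A on the facet
  \<open>e'\<close>. The sign comes from moving \<delta> past B, whose degree
  \<open>cdim G e - 2\<close> has the parity of \<open>cdim G e\<close>.\<close>

definition coupling :: "'a set \<Rightarrow> 'a set \<Rightarrow> ('a, 'm) fform" where
  "coupling e e' = (\<Sum>\<alpha>\<in>UNIV. \<Sum>\<beta>\<in>UNIV.
     scal (ksign (int (cdim G e)) * real_of_int (inc G e e') * cell_transport G P e e' $ \<alpha> $ \<beta>) *
       (b (Dual e) \<alpha> * da e' \<beta>))"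

text \<open>Cells are nonempty and the two boundary parts are disjoint.\<close>

lemma in_subset_bulk: "cells_in G \<subseteq> bulk"
proof
  fix e assume e: "e \<in> cells_in G"
  then have "e \<in> cells G" "e \<subseteq> mfd_in G" by (auto simp: cells_in_def)
  moreover have "e \<notin> cells_out G"
    using cell_nonempty[OF calculation(1)] calculation(2) disjoint unfolding cells_out_def by blast
  ultimately show "e \<in> bulk" by blast
qed

lemma out_adj_props:
  assumes "e' \<in> cells_out G"
  shows "out_adj G e' \<in> bulk" "e' \<in> facets G (out_adj G e')"
    and "\<And>e. e \<in> bulk \<Longrightarrow> e' \<in> facets G e \<Longrightarrow> e = out_adj G e'"
proof -
  have ex: "\<exists>!e. e \<in> cells G - cells_out G \<and> cdim G e = cdim G e' + 1 \<and> e' \<subset> e"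
    using bspec[OF product[unfolded product_type_out_def] assms] .
  from theI'[OF ex] have 1: "out_adj G e' \<in> bulk \<and> cdim G (out_adj G e') = cdim G e' + 1 \<and> e' \<subset> out_adj G e'"
    unfolding out_adj_def .
  then show "out_adj G e' \<in> bulk" "e' \<in> facets G (out_adj G e')"
    using assms unfolding facets_def cells_out_def by simp_all
  show "e = out_adj G e'" if "e \<in> bulk" "e' \<in> facets G e" for e
    using ex 1 that unfolding facets_def mem_Collect_eq by metis
qed

text \<open>In the prism \<kappa>(e') the two ends have incidence numbers given by
  \<open>incidence_out\<close> and \<open>incidence_facet\<close>; the powers of -1 in their product
  combine with the sign in \<open>out_sign\<close>.\<close>

lemma out_sign_eq:
  assumes "e' \<in> cells_out G"
  shows "out_sign G e' = inc G (out_adj G e') e'"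
proof -
  have e: "out_adj G e' \<in> cells G" "e' \<in> facets G (out_adj G e')"
    using out_adj_props(1,2)[OF assms] by auto
  then have d: "cdim G (out_adj G e') = Suc (cdim G e')" by (simp add: facets_def)
  show ?thesis
    unfolding out_sign_def incidence_facet[OF e] incidence_out[OF assms] d
    by (simp flip: power_mult_distrib mult.assoc)
qed

text \<open>Inclusion of carriers is inclusion of stars, so a face of \<kappa>(e) in codimension one
  comes from a bulk cell having \<open>e\<close> as a facet, or is the dual of \<open>e\<close>
  inside the incoming boundary.\<close>

lemma dual_facets_bulk:
  assumes "e \<in> bulk"
  shows "dual_facets G (Dual e) =
    Dual ` {e'\<in>bulk. e \<in> facets G e'} \<union> (if e \<in> cells_in G then {Dual_in e} else {})"
proof -
  have 1: "dual_carrier G (Dual e') \<subset> dual_carrier G (Dual e) \<longleftrightarrow> e \<subset> e'" if "e' \<in> cells G" for e'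
    using that assms unfolding dual_carrier_psubset_iff by auto
  have 2: "e' = e" if "dual_carrier G (Dual_in e') \<subset> dual_carrier G (Dual e)"
    "e' \<in> cells_in G" "cdim G e' = cdim G e" for e'
  proof -
    have "star_cells G (Dual_in e') \<subseteq> star_cells G (Dual e)"
      using that(1) dual_carrier_psubset_iff by blast
    then have "e \<subseteq> e'" using that(2) by auto
    then show ?thesis using cdim_less[of e' e] that assms by (auto simp: cells_in_def)
  qed
  \<comment> \<open>The inclusion is strict because a top flag of \<kappa>(e) contains a cell of
    dimension \<open>n\<close>, while incoming cells have smaller dimension.\<close>
  have 3: "dual_carrier G (Dual_in e) \<subset> dual_carrier G (Dual e)" if e: "e \<in> cells_in G"
  proof -
    have "star_cells G (Dual_in e) \<noteq> star_cells G (Dual e)"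
    proof
      assume eq: "star_cells G (Dual_in e) = star_cells G (Dual e)"
      have eG: "e \<in> cells G" using assms by blast
      obtain H where H: "or_dual G (Dual e) H \<noteq> 0" using ex_or_dual[OF eG] by blast
      have "dimM G \<in> set (map (cdim G) H)"
        unfolding or_dual_flag(2)[OF eG H] using cdim_le[OF eG] by simp
      then obtain c where "c \<in> set H" "cdim G c = dimM G" by auto
      moreover have "set H \<subseteq> cells_in G"
        using or_dual_flag(1)[OF eG H] eq by (auto simp: flags_def)
      ultimately show False
        using boundary_cdim_less[OF dual_in_orientation(1), of c] by auto
    qed
    moreover have "star_cells G (Dual_in e) \<subseteq> star_cells G (Dual e)" by (auto simp: cells_in_def)
    ultimately show ?thesis unfolding dual_carrier_psubset_iff by blast
  qed
  have dims: "ddim G (Dual e) = ddim G (Dual e') + 1 \<longleftrightarrow> cdim G e' = cdim G e + 1"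
    "ddim G (Dual e) = ddim G (Dual_in e') + 1 \<longleftrightarrow> cdim G e' = cdim G e" for e'
    by auto
  show ?thesis
  proof (intro set_eqI)
    fix c
    show "c \<in> dual_facets G (Dual e) \<longleftrightarrow>
      c \<in> Dual ` {e'\<in>bulk. e \<in> facets G e'} \<union> (if e \<in> cells_in G then {Dual_in e} else {})"
    proof (cases c)
      case (Dual e')
      then show ?thesis using 1[of e'] dims(1)[of e'] assms
        unfolding dual_facets_def dual_complex_def facets_def by auto
    next
      case (Dual_in e')
      then show ?thesis using 2[of e'] 3 dims(2)[of e']
        unfolding dual_facets_def dual_complex_def by auto
    next
      case (Dual_out e')
      then show ?thesis unfolding dual_facets_def dual_complex_def by auto
    qed
  qed
qed

text \<open>The order of summation is exchanged. By the product structure, each facet in the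
  outgoing boundary has exactly one adjacent bulk cell.\<close>

lemma sum_facets:
  fixes F :: "'a set \<Rightarrow> 'a set \<Rightarrow> 'b::comm_monoid_add"
  shows "(\<Sum>e\<in>bulk. \<Sum>e'\<in>facets G e. F e e') =
    (\<Sum>e'\<in>bulk. \<Sum>e | e \<in> bulk \<and> e' \<in> facets G e. F e e') + (\<Sum>e'\<in>cells_out G. F (out_adj G e') e')"
proof -
  have out: "cells_out G \<subseteq> cells G" by (auto simp: cells_out_def)
  have "(\<Sum>e\<in>bulk. \<Sum>e'\<in>facets G e. F e e') =
    (\<Sum>e\<in>bulk. \<Sum>e' | e' \<in> cells G \<and> e' \<in> facets G e. F e e')"
    by (intro sum.cong refl) (auto simp: facets_def)
  also have "\<dots> = (\<Sum>e'\<in>cells G. \<Sum>e | e \<in> bulk \<and> e' \<in> facets G e. F e e')"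
    using finite_cells by (intro sum.swap_restrict) auto
  also have "\<dots> = (\<Sum>e'\<in>bulk. \<Sum>e | e \<in> bulk \<and> e' \<in> facets G e. F e e') +
      (\<Sum>e'\<in>cells_out G. \<Sum>e | e \<in> bulk \<and> e' \<in> facets G e. F e e')"
    using finite_cells out by (intro sum.subset_diff) auto
  also have "(\<Sum>e | e \<in> bulk \<and> e' \<in> facets G e. F e e') = F (out_adj G e') e'"
    if "e' \<in> cells_out G" for e'
  proof -
    have "{e. e \<in> bulk \<and> e' \<in> facets G e} = {out_adj G e'}"
      using out_adj_props[OF that] by blast
    then show ?thesis by simp
  qed
  then have "(\<Sum>e'\<in>cells_out G. \<Sum>e | e \<in> bulk \<and> e' \<in> facets G e. F e e') =
    (\<Sum>e'\<in>cells_out G. F (out_adj G e') e')" by (rule sum.cong[OF refl])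
  finally show ?thesis .
qed

lemma de_Rham_action:
  "de_Rham deg (action G P) =
     (\<Sum>e\<in>bulk. \<Sum>\<alpha>\<in>UNIV. db (Dual e) \<alpha> * d_A G P A_field e \<alpha>)
     + (\<Sum>e\<in>bulk. \<Sum>e'\<in>facets G e. coupling e e')
     + (\<Sum>e\<in>cells_in G. \<Sum>\<alpha>\<in>UNIV. db (Dual_in e) \<alpha> * a e \<alpha>
          + scal (- ksign (int (cdim G e))) * (b (Dual_in e) \<alpha> * da e \<alpha>))"
proof -
  \<comment> \<open>The degrees are \<open>cdim G e - 2\<close> in the bulk and
    \<open>cdim G e - 1\<close> inside the incoming boundary, hence the opposite signs.\<close>
  have deg: "ksign (deg (BC (Dual e) \<alpha>)) = ksign (int (cdim G e))"
    "ksign (deg (BC (Dual_in e) \<alpha>)) = - ksign (int (cdim G e))" for e \<alpha>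
    by (simp_all add: ksign_def)
  let ?t = "\<lambda>e e' \<alpha> \<beta>. real_of_int (inc G e e') * cell_transport G P e e' $ \<alpha> $ \<beta>"
  have "de_Rham deg (pairing G B_field (d_A G P A_field)) =
    (\<Sum>e\<in>bulk. \<Sum>\<alpha>\<in>UNIV. \<Sum>e'\<in>facets G e. \<Sum>\<beta>\<in>UNIV. scal (?t e e' \<alpha> \<beta>) *
       (db (Dual e) \<alpha> * a e' \<beta> + scal (ksign (int (cdim G e))) * (b (Dual e) \<alpha> * da e' \<beta>)))"
    by (simp add: pairing_def A_field_def B_field_def d_A_def sum_distrib_left gens_scal_left_commute
        de_Rham_product[unfolded de_Rham_def] de_Rham_def derivation_sum derivation_scal deg
        del: field_deg.simps)
  also have "\<dots> = (\<Sum>e\<in>bulk. \<Sum>\<alpha>\<in>UNIV. db (Dual e) \<alpha> * d_A G P A_field e \<alpha>) +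
     (\<Sum>e\<in>bulk. \<Sum>\<alpha>\<in>UNIV. \<Sum>e'\<in>facets G e. \<Sum>\<beta>\<in>UNIV.
       scal (ksign (int (cdim G e)) * ?t e e' \<alpha> \<beta>) * (b (Dual e) \<alpha> * da e' \<beta>))"
    by (simp add: d_A_def A_field_def sum_distrib_left gens_scal_left_commute distrib_left sum.distrib scal_scal
        mult.commute mult.left_commute)
  also have "(\<Sum>e\<in>bulk. \<Sum>\<alpha>\<in>UNIV. \<Sum>e'\<in>facets G e. \<Sum>\<beta>\<in>UNIV.
       scal (ksign (int (cdim G e)) * ?t e e' \<alpha> \<beta>) * (b (Dual e) \<alpha> * da e' \<beta>)) =
     (\<Sum>e\<in>bulk. \<Sum>e'\<in>facets G e. coupling e e')"
    unfolding coupling_def mult.assoc[symmetric] by (intro sum.cong refl sum.swap)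
  finally have 1: "de_Rham deg (pairing G B_field (d_A G P A_field)) =
     (\<Sum>e\<in>bulk. \<Sum>\<alpha>\<in>UNIV. db (Dual e) \<alpha> * d_A G P A_field e \<alpha>)
     + (\<Sum>e\<in>bulk. \<Sum>e'\<in>facets G e. coupling e e')" .
  have 2: "de_Rham deg (pairing_in G B_field A_field) =
     (\<Sum>e\<in>cells_in G. \<Sum>\<alpha>\<in>UNIV. db (Dual_in e) \<alpha> * a e \<alpha>
          + scal (- ksign (int (cdim G e))) * (b (Dual_in e) \<alpha> * da e \<alpha>))"
    by (simp add: pairing_in_def A_field_def B_field_def
        de_Rham_product[unfolded de_Rham_def] de_Rham_def derivation_sum deg
        del: field_deg.simps)
  show ?thesis unfolding action_def de_Rham_def derivation_add
    unfolding de_Rham_def[symmetric] 1 2 ..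
qed

text \<open>The equations for \<open>Q\<close> are congruences, so this is where literal equality of
  forms gives way to \<open>form_eq\<close>.\<close>

lemma contract_omega:
  assumes "Q_equations G P Q"
  shows "form_eq deg (contract deg Q (omega G))
    ((\<Sum>e\<in>bulk. \<Sum>\<alpha>\<in>UNIV. db (Dual e) \<alpha> * d_A G P A_field e \<alpha>)
     + (\<Sum>e\<in>bulk. \<Sum>\<alpha>\<in>UNIV. scal (ksign (int (cdim G e))) *
          d_B G P (int (dimM G) - 2) B_field (Dual e) \<alpha> * da e \<alpha>))"
proof -
  have app: "apply_vf deg Q (gens [Co x]) = Q x" for x
    by (simp add: apply_vf_def contract_def derivation_gens1)
  have QA: "form_eq deg (scal (ksign (int (cdim G e))) * Q (AC e \<alpha>)) (d_A G P A_field e \<alpha>)"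
    if "e \<in> cells G" for e \<alpha>
    using assms that unfolding Q_equations_def on_A_def A_field_def app by simp
  have QB: "form_eq deg (Q (BC c \<alpha>)) (d_B G P (int (dimM G) - 2) B_field c \<alpha>)"
    if "c \<in> dual_complex G" for c \<alpha>
    using assms that unfolding Q_equations_def on_B_def B_field_def app by simp
  \<comment> \<open>The sign with which \<delta> passes the basis cochain in \<open>omega\<close> is
    the one with which \<open>Q\<close> passes it in \<open>Q_equations\<close>, so the second
    factor becomes dA without further signs.\<close>
  have "contract deg Q (omega G) =
    (\<Sum>e\<in>bulk. \<Sum>\<alpha>\<in>UNIV. db (Dual e) \<alpha> * (scal (ksign (int (cdim G e))) * Q (AC e \<alpha>)) +
      scal (ksign (int (cdim G e))) * Q (BC (Dual e) \<alpha>) * da e \<alpha>)"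
    by (simp add: omega_def pairing_def on_A_def on_B_def A_field_def B_field_def gens_scal_left_commute
      contract_product[unfolded contract_def] contract_def derivation_sum derivation_scal distrib_left
      mult.assoc add.commute)
  moreover have "form_eq deg \<dots> (\<Sum>e\<in>bulk. \<Sum>\<alpha>\<in>UNIV. db (Dual e) \<alpha> * d_A G P A_field e \<alpha> +
      scal (ksign (int (cdim G e))) * d_B G P (int (dimM G) - 2) B_field (Dual e) \<alpha> * da e \<alpha>)"
  proof (intro form_eq_sum form_eq_add)
    fix e \<alpha> assume e: "e \<in> bulk"
    show "form_eq deg (db (Dual e) \<alpha> * (scal (ksign (int (cdim G e))) * Q (AC e \<alpha>)))
        (db (Dual e) \<alpha> * d_A G P A_field e \<alpha>)"
      using form_eq_mult[OF QA[of e \<alpha>], of "db (Dual e) \<alpha>" 1] e by simp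
    show "form_eq deg (scal (ksign (int (cdim G e))) * Q (BC (Dual e) \<alpha>) * da e \<alpha>)
       (scal (ksign (int (cdim G e))) * d_B G P (int (dimM G) - 2) B_field (Dual e) \<alpha> * da e \<alpha>)"
      using e by (intro form_eq_mult QB) (simp add: dual_complex_def)
  qed
  ultimately show ?thesis by (simp add: sum.distrib)
qed

text \<open>The coboundary of B at \<kappa>(e) is split over the faces of \<kappa>(e); duality of
  incidence numbers and transports turns the bulk faces into couplings.\<close>

lemma contract_omega_B:
  assumes e: "e \<in> bulk"
  shows "(\<Sum>\<alpha>\<in>UNIV. scal (ksign (int (cdim G e))) *
          d_B G P (int (dimM G) - 2) B_field (Dual e) \<alpha> * da e \<alpha>) =
    (\<Sum>e' | e' \<in> bulk \<and> e \<in> facets G e'. coupling e' e) +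
    (if e \<in> cells_in G then \<Sum>\<alpha>\<in>UNIV. scal (- ksign (int (cdim G e))) * (b (Dual_in e) \<alpha> * da e \<alpha>) else 0)"
proof -
  let ?n = "int (dimM G)" and ?s = "ksign (int (cdim G e))" and ?I = "{e'\<in>bulk. e \<in> facets G e'}"
  define f where "f c \<alpha> \<beta> = scal (?s * ksign (?n - 2 - ddim G c) * real_of_int (dual_inc G (Dual e) c) *
            dual_transport G P (Dual e) c $ \<alpha> $ \<beta>) * (b c \<beta> * da e \<alpha>)" for c \<alpha> \<beta>
  have "(\<Sum>\<alpha>\<in>UNIV. scal ?s * d_B G P (?n - 2) B_field (Dual e) \<alpha> * da e \<alpha>) =
    (\<Sum>\<alpha>\<in>UNIV. \<Sum>c\<in>dual_facets G (Dual e). \<Sum>\<beta>\<in>UNIV. f c \<alpha> \<beta>)"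
    by (simp add: d_B_def B_field_def f_def sum_distrib_left sum_distrib_right scal_scal mult.assoc)
  also have "\<dots> = (\<Sum>c\<in>dual_facets G (Dual e). \<Sum>\<alpha>\<in>UNIV. \<Sum>\<beta>\<in>UNIV. f c \<alpha> \<beta>)"
    by (rule sum.swap)
  also have "\<dots> = (\<Sum>c\<in>Dual ` ?I. \<Sum>\<alpha>\<in>UNIV. \<Sum>\<beta>\<in>UNIV. f c \<alpha> \<beta>) +
     (\<Sum>c\<in>(if e \<in> cells_in G then {Dual_in e} else {}). \<Sum>\<alpha>\<in>UNIV. \<Sum>\<beta>\<in>UNIV. f c \<alpha> \<beta>)"
    unfolding dual_facets_bulk[OF e] using finite_cells by (intro sum.union_disjoint) auto
  also have "(\<Sum>c\<in>Dual ` ?I. \<Sum>\<alpha>\<in>UNIV. \<Sum>\<beta>\<in>UNIV. f c \<alpha> \<beta>) =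
      (\<Sum>e'\<in>?I. \<Sum>\<alpha>\<in>UNIV. \<Sum>\<beta>\<in>UNIV. f (Dual e') \<alpha> \<beta>)"
    by (subst sum.reindex) (auto simp: inj_on_def)
  also have "\<dots> = (\<Sum>e'\<in>?I. coupling e' e)"
  proof (rule sum.cong[OF refl])
    fix e' assume "e' \<in> ?I"
    then have e': "e' \<in> cells G" "e \<in> facets G e'" by auto
    then have d: "cdim G e' = Suc (cdim G e)" "e \<subseteq> e'" by (auto simp: facets_def)
    have tr: "dual_transport G P (Dual e) (Dual e') $ \<alpha> $ \<beta> = cell_transport G P e' e $ \<beta> $ \<alpha>" for \<alpha> \<beta>
      using dual_transport_eq[OF flat e'(1) _ d(2)] e by (simp add: transpose_def)
    \<comment> \<open>The sign of d passing B has the parity of \<open>cdim G e'\<close> and cancels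
      the power in \<open>incidence_facet\<close>; the remaining minus sign changes
      \<open>cdim G e\<close> into \<open>cdim G e'\<close>.\<close>
    have s: "?s * ksign (?n - 2 - ddim G (Dual e')) * real_of_int (dual_inc G (Dual e) (Dual e')) =
      ksign (int (cdim G e')) * real_of_int (inc G e' e)"
      unfolding incidence_facet[OF e'] by (simp add: ksign_def d(1))
    show "(\<Sum>\<alpha>\<in>UNIV. \<Sum>\<beta>\<in>UNIV. f (Dual e') \<alpha> \<beta>) = coupling e' e"
      unfolding f_def coupling_def s tr by (rule sum.swap)
  qed
  also have "(\<Sum>\<alpha>\<in>UNIV. \<Sum>\<beta>\<in>UNIV. f (Dual_in e) \<alpha> \<beta>) =
    (\<Sum>\<alpha>\<in>UNIV. scal (- ?s) * (b (Dual_in e) \<alpha> * da e \<alpha>))" if i: "e \<in> cells_in G"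
  proof (rule sum.cong[OF refl])
    fix \<alpha> :: 'm
    \<comment> \<open>The sign of d passing B has the parity of \<open>cdim G e - 1\<close>, and
      \<open>incidence_in\<close> contributes that of \<open>cdim G e\<close>; together they give
      -1.\<close>
    have s: "?s * ksign (?n - 2 - ddim G (Dual_in e)) * real_of_int (dual_inc G (Dual e) (Dual_in e)) = - ?s"
      unfolding incidence_in[OF i] by (simp add: ksign_def)
    have "(\<Sum>\<beta>\<in>UNIV. f (Dual_in e) \<alpha> \<beta>) = (\<Sum>\<beta>\<in>UNIV. if \<alpha> = \<beta> then scal (- ?s) * (b (Dual_in e) \<beta> * da e \<alpha>) else 0)"
      unfolding f_def s using dual_transport_in[OF flat] e
      by (intro sum.cong refl) (simp add: mat_def)
    then show "(\<Sum>\<beta>\<in>UNIV. f (Dual_in e) \<alpha> \<beta>) = scal (- ?s) * (b (Dual_in e) \<alpha> * da e \<alpha>)"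
      by simp
  qed
  then have "(\<Sum>c\<in>(if e \<in> cells_in G then {Dual_in e} else {}). \<Sum>\<alpha>\<in>UNIV. \<Sum>\<beta>\<in>UNIV. f c \<alpha> \<beta>) =
    (if e \<in> cells_in G then \<Sum>\<alpha>\<in>UNIV. scal (- ?s) * (b (Dual_in e) \<alpha> * da e \<alpha>) else 0)"
    by simp
  finally show ?thesis by simp
qed

text \<open>The projection keeps the incoming coordinates, while outgoing B is transported from the
  adjacent bulk cell, which produces a coupling.\<close>

lemma pullback_alpha:
  "pullback deg (bdry_proj G P) (alpha_bdry G) =
     - (\<Sum>e\<in>cells_out G. coupling (out_adj G e) e)
     - (\<Sum>e\<in>cells_in G. \<Sum>\<alpha>\<in>UNIV. db (Dual_in e) \<alpha> * a e \<alpha>)"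
proof -
  let ?f = "bdry_proj G P"
  have 1: "pullback deg ?f (db (Dual_in e) \<alpha> * a e \<alpha>) = db (Dual_in e) \<alpha> * a e \<alpha>" for e \<alpha>
    by (simp add: gens_mult pullback_gens2 B_field_def A_field_def)
  have 2: "(\<Sum>\<alpha>\<in>UNIV. scal (ksign (int (cdim G e))) * pullback deg ?f (b (Dual_out e) \<alpha> * da e \<alpha>))
    = - coupling (out_adj G e) e" if e: "e \<in> cells_out G" for e
  proof -
    let ?e = "out_adj G e"
    have e': "?e \<in> cells G" "e \<in> cells G" "e \<subseteq> ?e" "cdim G ?e = Suc (cdim G e)"
      using out_adj_props(1,2)[OF e] by (auto simp: facets_def)
    let ?c = "\<lambda>\<alpha> \<beta>. ksign (int (cdim G ?e)) * real_of_int (inc G ?e e) * cell_transport G P ?e e $ \<beta> $ \<alpha>"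
    have tr: "transport_in (dual_bundle P) ?e (barycenter G ?e) (barycenter G e) $ \<alpha> $ \<beta> =
      cell_transport G P ?e e $ \<beta> $ \<alpha>" for \<alpha> \<beta>
      using cell_dual_transport_eq[OF flat e'(1-3)] by (simp add: transpose_def)
    \<comment> \<open>The adjacent cell has one dimension more; this is the origin of the minus sign
      in front of the coupling.\<close>
    have s: "ksign (int (cdim G e)) = - ksign (int (cdim G ?e))"
      by (simp add: e'(4) ksign_def)
    have "scal (ksign (int (cdim G e))) * pullback deg ?f (b (Dual_out e) \<alpha> * da e \<alpha>) =
      - (\<Sum>\<beta>\<in>UNIV. scal (?c \<alpha> \<beta>) * (b (Dual ?e) \<beta> * da e \<alpha>))" for \<alpha>
      by (simp add: pullback_gens2 gens_mult B_field_def A_field_def Let_def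
        s out_sign_eq[OF e] tr sum_distrib_left sum_distrib_right mult.assoc scal_scal scal_minus sum_negf)
    then show ?thesis unfolding coupling_def
      by (subst sum.swap) (simp add: sum_negf)
  qed
  have "pullback deg ?f (alpha_bdry G) =
    (\<Sum>e\<in>cells_out G. \<Sum>\<alpha>\<in>UNIV. scal (ksign (int (cdim G e))) * pullback deg ?f (b (Dual_out e) \<alpha> * da e \<alpha>))
    - (\<Sum>e\<in>cells_in G. \<Sum>\<alpha>\<in>UNIV. pullback deg ?f (db (Dual_in e) \<alpha> * a e \<alpha>))"
    by (simp add: alpha_bdry_def pairing_out_def pairing_in_def on_A_def on_B_def A_field_def B_field_def
      pullback_diff pullback_sum pullback_scal gens_scal_left_commute)
  then show ?thesis unfolding 1 by (simp add: 2 sum_negf)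
qed

text \<open>Couplings at bulk facets come from QB and those at outgoing facets from the boundary
  form. On the incoming boundary the B \<delta>A terms come from QB and the \<delta>B A terms from
  the boundary form.\<close>

lemma action_variation:
  assumes "Q_equations G P Q"
  shows "form_eq deg (de_Rham deg (action G P))
    (contract deg Q (omega G) - pullback deg (bdry_proj G P) (alpha_bdry G))"
proof -
  have sub: "cells_in G \<subseteq> bulk" "finite bulk" using in_subset_bulk finite_cells by auto
  have "(\<Sum>e\<in>bulk. \<Sum>\<alpha>\<in>UNIV. scal (ksign (int (cdim G e))) *
          d_B G P (int (dimM G) - 2) B_field (Dual e) \<alpha> * da e \<alpha>) =
    (\<Sum>e\<in>bulk. \<Sum>e' | e' \<in> bulk \<and> e \<in> facets G e'. coupling e' e) +
    (\<Sum>e\<in>cells_in G. \<Sum>\<alpha>\<in>UNIV. scal (- ksign (int (cdim G e))) * (b (Dual_in e) \<alpha> * da e \<alpha>))"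
    using sub by (simp add: contract_omega_B sum.distrib sum.If_cases Int_absorb1 del: scal_minus)
  then have "de_Rham deg (action G P) =
    (\<Sum>e\<in>bulk. \<Sum>\<alpha>\<in>UNIV. db (Dual e) \<alpha> * d_A G P A_field e \<alpha>)
     + (\<Sum>e\<in>bulk. \<Sum>\<alpha>\<in>UNIV. scal (ksign (int (cdim G e))) *
          d_B G P (int (dimM G) - 2) B_field (Dual e) \<alpha> * da e \<alpha>)
     - pullback deg (bdry_proj G P) (alpha_bdry G)"
    unfolding de_Rham_action pullback_alpha sum_facets by (simp add: sum.distrib algebra_simps)
  then show ?thesis
    using form_eq_add[OF form_eq_sym[OF contract_omega[OF assms]]
        form_eq_refl[of _ "- pullback deg (bdry_proj G P) (alpha_bdry G)"]]
    by simp
qed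

end

theorem proposition6p1:
  fixes G :: "'a::euclidean_space cw_cobordism"
    and P :: "(real \<Rightarrow> 'a) \<Rightarrow> real^'m^'m::finite"
    and \<mu> :: "'a \<Rightarrow> real"
    and Q :: "('a set, 'm) coord \<Rightarrow> ('a, 'm) fform"
  assumes "PL_cobordism G"
    and "regular_cw G"
    and "product_type_out G"
    and "barycentric_subdivision G"
    and "oriented G"
    and "dual_oriented G"
    and "flat_bundle (mfd G) P"
    and "horizontal_density (mfd G) P \<mu>"
    and "Q_equations G P Q"
  shows "form_eq (field_deg G)
           (de_Rham (field_deg G) (action G P))
           (contract (field_deg G) Q (omega G)
              - pullback (field_deg G) (bdry_proj G P) (alpha_bdry G))"
proof -
  \<comment> \<open>Finiteness is taken from the CW structure and disjointness of the two boundary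
    parts from the cobordism.\<close>
  interpret cobordism_cells G P
    using assms by unfold_locales (auto simp: regular_cw_def PL_cobordism_def)
  show ?thesis using assms(9) by (rule action_variation)
qed

end
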